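(* Let $\Gamma\curvearrowright X$ be a Borel action of a finitely generated group $\Gamma$ on a standard Borel space $X$. Suppose that the asymptotic separation index of the action $\Gamma\curvearrowright X$ is finite. If a Borel set $A\subseteq X$ is $\Gamma$-paradoxical, then it has a paradoxical decomposition using Borel pieces.
   Context: An action of $\Gamma$ on $X$ is Borel if for each $\gamma\in\Gamma$ the map $x\mapsto\gamma\cdot x$ is Borel. Two sets $A,B\subseteq X$ are equidecomposable by $\Gamma$, written $A\approx_\Gamma B$, if for some $k\in\mathbb{N}$ there are partitions $A=A_1\sqcup\dots\sqcup A_k$ and $B=B_1\sqcup\dots\sqcup B_k$ such that each $B_i$ is a $\Gamma$-translate of $A_i$, i.e. $B_i=\gamma_i\cdot A_i$ for some $\gamma_i\in\Gamma$. The sets $A_i,B_i$ are the pieces of the equidecomposition. A set $A\subseteq X$ is $\Gamma$-paradoxical if it has a paradoxical decomposition, i.e. a partition $A=A_0\sqcup A_1$ with $A\approx_\Gamma A_0$ and $A\approx_\Gamma A_1$. A paradoxical decomposition uses Borel pieces if the equidecompositions witnessing $A\approx_\Gamma A_0$ and $A\approx_\Gamma A_1$ can be chosen with all pieces Borel. Asymptotic separation index: For a finite generating set $S$ of $\Gamma$, the Schreier graph $\mathsf{Sch}(X,\Gamma,S)$ is the simple graph with vertex set $X$ and edge set $\{\{x,\sigma\cdot x\}: x\in X,\ \sigma\in S,\ x\ne\sigma\cdot x\}$. The asymptotic separation index of $\Gamma\curvearrowright X$ is $\mathsf{asi}(\Gamma\curvearrowright X)=\mathsf{asi}(\mathsf{Sch}(X,\Gamma,S))$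 for any (equivalently, every) finite generating set $S$, where for a simple locally finite Borel graph $G$ (i.e. one whose vertex set is standard Borel, whose edge relation is Borel, and all of whose vertices have finite degree), $\mathsf{asi}(G)$ is the smallest $s\in\mathbb{N}$ such that for every $k\in\mathbb{N}$ the vertex set of $G$ can be covered by $s+1$ Borel $G^k$-finite sets, and $\mathsf{asi}(G)=\infty$ if no such $s$ exists. Here $G^k$ is the simple graph on the same vertex set in which $\{x,y\}$ is an edge iff $0<\mathrm{dist}_G(x,y)\le k$, and a set $Y$ of vertices of a graph $H$ is $H$-finite if every connected component of the induced subgraph $H[Y]$ is finite. *)

theory Defs
  imports "HOL-Analysis.Analysis" "HOL-Algebra.Group_Action" "HOL-Algebra.Generated_Groups"
begin

section \<open>Standard Borel spaces and Borel actions\<close>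

text \<open>
  Borel structures are represented by the type \<^typ>\<open>'a measure\<close>; only the space and the
  sigma-algebra are used, never the measure.
\<close>

definition standard_borel :: "'a measure \<Rightarrow> bool" where
  "standard_borel M \<longleftrightarrow>
     (\<exists>T. completely_metrizable_space T \<and> second_countable T \<and>
          topspace T = space M \<and> sets M = sigma_sets (space M) {U. openin T U})"

definition borel_action :: "('g, 'r) monoid_scheme \<Rightarrow> 'a measure \<Rightarrow> ('g \<Rightarrow> 'a \<Rightarrow> 'a) \<Rightarrow> bool" where
  "borel_action G M \<phi> \<longleftrightarrow>
     group_action G (space M) \<phi> \<and> (\<forall>g\<in>carrier G. \<phi> g \<in> measurable M M)"

definition finite_generating_set :: "('g, 'r) monoid_scheme \<Rightarrow> 'g set \<Rightarrow> bool" where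
  "finite_generating_set G S \<longleftrightarrow> finite S \<and> S \<subseteq> carrier G \<and> generate G S = carrier G"

definition finitely_generated :: "('g, 'r) monoid_scheme \<Rightarrow> bool" where
  "finitely_generated G \<longleftrightarrow> (\<exists>S. finite_generating_set G S)"


section \<open>Equidecomposability and paradoxical sets\<close>

text \<open>Pieces are allowed to be empty.\<close>

definition equidecomposition ::
    "('g, 'r) monoid_scheme \<Rightarrow> ('g \<Rightarrow> 'a \<Rightarrow> 'a) \<Rightarrow> 'a set \<Rightarrow> 'a set
      \<Rightarrow> nat \<Rightarrow> (nat \<Rightarrow> 'a set) \<Rightarrow> (nat \<Rightarrow> 'a set) \<Rightarrow> bool" where
  "equidecomposition G \<phi> A B k P Q \<longleftrightarrow>
     (\<Union>i<k. P i) = A \<and> disjoint_family_on P {..<k} \<and>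
     (\<Union>i<k. Q i) = B \<and> disjoint_family_on Q {..<k} \<and>
     (\<forall>i<k. \<exists>g\<in>carrier G. Q i = \<phi> g ` P i)"

definition equidecomposable ::
    "('g, 'r) monoid_scheme \<Rightarrow> ('g \<Rightarrow> 'a \<Rightarrow> 'a) \<Rightarrow> 'a set \<Rightarrow> 'a set \<Rightarrow> bool" where
  "equidecomposable G \<phi> A B \<longleftrightarrow> (\<exists>k P Q. equidecomposition G \<phi> A B k P Q)"

definition borel_equidecomposable ::
    "('g, 'r) monoid_scheme \<Rightarrow> 'a measure \<Rightarrow> ('g \<Rightarrow> 'a \<Rightarrow> 'a) \<Rightarrow> 'a set \<Rightarrow> 'a set \<Rightarrow> bool" where
  "borel_equidecomposable G M \<phi> A B \<longleftrightarrow>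
     (\<exists>k P Q. equidecomposition G \<phi> A B k P Q \<and> (\<forall>i<k. P i \<in> sets M \<and> Q i \<in> sets M))"

definition paradoxical :: "('g, 'r) monoid_scheme \<Rightarrow> ('g \<Rightarrow> 'a \<Rightarrow> 'a) \<Rightarrow> 'a set \<Rightarrow> bool" where
  "paradoxical G \<phi> A \<longleftrightarrow>
     (\<exists>A0 A1. A = A0 \<union> A1 \<and> A0 \<inter> A1 = {} \<and>
        equidecomposable G \<phi> A A0 \<and> equidecomposable G \<phi> A A1)"

definition borel_paradoxical ::
    "('g, 'r) monoid_scheme \<Rightarrow> 'a measure \<Rightarrow> ('g \<Rightarrow> 'a \<Rightarrow> 'a) \<Rightarrow> 'a set \<Rightarrow> bool" where
  "borel_paradoxical G M \<phi> A \<longleftrightarrow>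
     (\<exists>A0 A1. A = A0 \<union> A1 \<and> A0 \<inter> A1 = {} \<and>
        borel_equidecomposable G M \<phi> A A0 \<and> borel_equidecomposable G M \<phi> A A1)"


section \<open>Simple graphs and asymptotic separation index\<close>

text \<open>
  A simple graph is given by its set of edges, which are two-element sets of vertices.  The
  vertex set is only needed for the covering condition in the asymptotic separation index, where
  it is the space of the Borel structure.
\<close>

definition adj :: "'a set set \<Rightarrow> ('a \<times> 'a) set" where
  "adj E = {(x, y). {x, y} \<in> E}"

text \<open>The infimum of the empty set is infinity, the distance between different components.\<close>

definition graph_dist :: "'a set set \<Rightarrow> 'a \<Rightarrow> 'a \<Rightarrow> enat" where
  "graph_dist E x y = Inf {enat n | n. (x, y) \<in> adj E ^^ n}"

definition graph_power :: "'a set set \<Rightarrow> nat \<Rightarrow> 'a set set" where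
  "graph_power E k = {{x, y} | x y. 0 < graph_dist E x y \<and> graph_dist E x y \<le> enat k}"

definition induced_edges :: "'a set set \<Rightarrow> 'a set \<Rightarrow> 'a set set" where
  "induced_edges E Y = {e \<in> E. e \<subseteq> Y}"

definition component :: "'a set set \<Rightarrow> 'a \<Rightarrow> 'a set" where
  "component E x = {y. (x, y) \<in> (adj E)\<^sup>*}"

definition graph_finite :: "'a set set \<Rightarrow> 'a set \<Rightarrow> bool" where
  "graph_finite E Y \<longleftrightarrow> (\<forall>y\<in>Y. finite (component (induced_edges E Y) y))"

text \<open>The infimum of a nonempty set of extended naturals is its least element, and it is
  infinity for the empty set.\<close>

definition asi :: "'a measure \<Rightarrow> 'a set set \<Rightarrow> enat" where
  "asi M E = Inf {enat s | s. \<forall>k. \<exists>Y :: nat \<Rightarrow> 'a set.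
     (\<forall>i\<le>s. Y i \<in> sets M \<and> graph_finite (graph_power E k) (Y i)) \<and> (\<Union>i\<le>s. Y i) = space M}"

definition schreier :: "'a set \<Rightarrow> ('g \<Rightarrow> 'a \<Rightarrow> 'a) \<Rightarrow> 'g set \<Rightarrow> 'a set set" where
  "schreier X \<phi> S = {{x, \<phi> \<sigma> x} | x \<sigma>. x \<in> X \<and> \<sigma> \<in> S \<and> x \<noteq> \<phi> \<sigma> x}"

text \<open>
  The choice of generating set is immaterial, see \<open>asi_action_eq\<close> below.
\<close>

definition asi_action :: "('g, 'r) monoid_scheme \<Rightarrow> 'a measure \<Rightarrow> ('g \<Rightarrow> 'a \<Rightarrow> 'a) \<Rightarrow> enat" where
  "asi_action G M \<phi> = asi M (schreier (space M) \<phi> (SOME S. finite_generating_set G S))"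


subsection \<open>Independence of the generating set\<close>

lemma sym_adj: "sym (adj E)"
  by (auto simp: sym_def adj_def insert_commute)

lemma relpow_reflcl_le: "(x, y) \<in> (R\<^sup>=) ^^ n \<longleftrightarrow> (\<exists>m\<le>n. (x, y) \<in> R ^^ m)"
proof (induction n arbitrary: y)
  case 0
  show ?case by simp
next
  case IH: (Suc n)
  show ?case
  proof
    assume "(x, y) \<in> (R\<^sup>=) ^^ Suc n"
    then obtain z where z: "(x, z) \<in> (R\<^sup>=) ^^ n" "(z, y) \<in> R\<^sup>=" by (rule relpow_Suc_E)
    then obtain m where m: "m \<le> n" "(x, z) \<in> R ^^ m" using IH by blast
    show "\<exists>m\<le>Suc n. (x, y) \<in> R ^^ m"
    proof (cases "z = y")
      case True
      then show ?thesis using m le_SucI by blast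
    next
      case False
      then have "(x, y) \<in> R ^^ Suc m" using m z by (blast intro: relpow_Suc_I)
      then show ?thesis using m by (intro exI[of _ "Suc m"]) simp
    qed
  next
    assume "\<exists>m\<le>Suc n. (x, y) \<in> R ^^ m"
    then obtain m where m: "m \<le> Suc n" "(x, y) \<in> R ^^ m" by blast
    show "(x, y) \<in> (R\<^sup>=) ^^ Suc n"
    proof (cases "m \<le> n")
      case True
      then have "(x, y) \<in> (R\<^sup>=) ^^ n" using IH m by blast
      then show ?thesis by (blast intro: relpow_Suc_I)
    next
      case False
      then have "(x, y) \<in> R ^^ Suc n" using m by (metis le_SucE)
      then obtain z where "(x, z) \<in> R ^^ n" "(z, y) \<in> R" by (rule relpow_Suc_E)
      moreover from this have "(x, z) \<in> (R\<^sup>=) ^^ n" using IH by blast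
      ultimately show ?thesis by (blast intro: relpow_Suc_I)
    qed
  qed
qed

lemma relpow_subset: "R \<subseteq> Q \<Longrightarrow> R ^^ n \<subseteq> Q ^^ n" for R Q :: "('a \<times> 'a) set"
  by (induction n) auto

lemma relpow_relpow: "(R ^^ m) ^^ k = R ^^ (m * k)" for R :: "('a \<times> 'a) set"
  by (induction k) (simp_all add: relpow_add[symmetric] add.commute)

lemma relpow_sym: "sym R \<Longrightarrow> sym (R ^^ n)"
proof (induction n)
  case (Suc n)
  show ?case
  proof (rule symI)
    fix x y assume "(x, y) \<in> R ^^ Suc n"
    then obtain z where "(x, z) \<in> R ^^ n" "(z, y) \<in> R" by (rule relpow_Suc_E)
    then have "(y, z) \<in> R" "(z, x) \<in> R ^^ n" using Suc by (blast dest: symD)+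
    then show "(y, x) \<in> R ^^ Suc n" by (rule relpow_Suc_I2)
  qed
qed (simp add: sym_Id)

lemma graph_dist_le_iff: "graph_dist E x y \<le> enat n \<longleftrightarrow> (x, y) \<in> ((adj E)\<^sup>=) ^^ n"
proof -
  let ?A = "{enat n | n. (x, y) \<in> adj E ^^ n}"
  have "Inf ?A \<le> enat n \<longleftrightarrow> (\<exists>m\<le>n. (x, y) \<in> adj E ^^ m)"
  proof
    assume le: "Inf ?A \<le> enat n"
    then have ne: "?A \<noteq> {}"
      by (metis Inf_enat_def enat_ord_simps(5) infinity_ileE)
    then obtain a where "a \<in> ?A" by (auto simp only: ex_in_conv[symmetric])
    then have "(LEAST x. x \<in> ?A) \<in> ?A" by (rule LeastI)
    moreover have "Inf ?A = (LEAST x. x \<in> ?A)" unfolding Inf_enat_def using ne by (rule if_not_P)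
    ultimately have "Inf ?A \<in> ?A" by (simp only:)
    then show "\<exists>m\<le>n. (x, y) \<in> adj E ^^ m" using le by auto
  next
    assume "\<exists>m\<le>n. (x, y) \<in> adj E ^^ m"
    then obtain m where m: "m \<le> n" "(x, y) \<in> adj E ^^ m" by auto
    then have "Inf ?A \<le> enat m" by (intro Inf_lower) auto
    then show "Inf ?A \<le> enat n" using m by (meson enat_ord_simps(1) order_trans)
  qed
  then show ?thesis by (simp add: graph_dist_def relpow_reflcl_le)
qed

lemma graph_dist_pos_iff: "0 < graph_dist E x y \<longleftrightarrow> x \<noteq> y"
  using graph_dist_le_iff[of E x y 0] by (auto simp: zero_enat_def[symmetric])

lemma graph_power_mono:
  assumes "((adj E)\<^sup>=) ^^ k \<subseteq> ((adj F)\<^sup>=) ^^ l"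
  shows "graph_power E k \<subseteq> graph_power F l"
  unfolding graph_power_def graph_dist_pos_iff graph_dist_le_iff using assms by blast

lemma graph_finite_antimono:
  assumes "E \<subseteq> F" "graph_finite F Y"
  shows "graph_finite E Y"
proof -
  have "adj (induced_edges E Y) \<subseteq> adj (induced_edges F Y)"
    using assms(1) by (auto simp: adj_def induced_edges_def)
  then have "component (induced_edges E Y) y \<subseteq> component (induced_edges F Y) y" for y
    unfolding component_def using rtrancl_mono by blast
  then show ?thesis using assms(2) unfolding graph_finite_def by (meson finite_subset)
qed

lemma asi_mono:
  fixes M :: "'a measure"
  assumes "\<And>k. \<exists>l. graph_power E k \<subseteq> graph_power F l"
  shows "asi M E \<le> asi M F"
  unfolding asi_def
proof (rule Inf_superset_mono, rule subsetI)
  fix a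
  assume "a \<in> {enat s | s. \<forall>k. \<exists>Y :: nat \<Rightarrow> 'a set.
     (\<forall>i\<le>s. Y i \<in> sets M \<and> graph_finite (graph_power F k) (Y i)) \<and> (\<Union>i\<le>s. Y i) = space M}"
  then obtain s where a: "a = enat s" and s: "\<And>k. \<exists>Y :: nat \<Rightarrow> 'a set.
     (\<forall>i\<le>s. Y i \<in> sets M \<and> graph_finite (graph_power F k) (Y i)) \<and> (\<Union>i\<le>s. Y i) = space M"
    by (elim CollectE exE conjE) (rule that, assumption, erule spec)
  have "\<exists>Y :: nat \<Rightarrow> 'a set. (\<forall>i\<le>s. Y i \<in> sets M \<and> graph_finite (graph_power E k) (Y i)) \<and>
      (\<Union>i\<le>s. Y i) = space M" for k
  proof -
    obtain l where l: "graph_power E k \<subseteq> graph_power F l" using assms by (rule exE)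
    obtain Y :: "nat \<Rightarrow> 'a set" where
      Y: "\<forall>i\<le>s. Y i \<in> sets M \<and> graph_finite (graph_power F l) (Y i)" "(\<Union>i\<le>s. Y i) = space M"
      using s[of l] by (elim exE conjE) (rule that)
    have "\<forall>i\<le>s. Y i \<in> sets M \<and> graph_finite (graph_power E k) (Y i)"
      using Y(1) graph_finite_antimono[OF l] by simp
    with Y(2) show ?thesis by (intro exI[of _ Y] conjI)
  qed
  then show "a \<in> {enat s | s. \<forall>k. \<exists>Y :: nat \<Rightarrow> 'a set.
     (\<forall>i\<le>s. Y i \<in> sets M \<and> graph_finite (graph_power E k) (Y i)) \<and> (\<Union>i\<le>s. Y i) = space M}"
    using a by (intro CollectI exI[of _ s] conjI allI)
qed

lemma relpow_reflcl_mono: "m \<le> n \<Longrightarrow> (R\<^sup>=) ^^ m \<subseteq> (R\<^sup>=) ^^ n"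
  unfolding subset_iff split_paired_All relpow_reflcl_le by (meson order_trans)

lemma generate_moves_bounded:
  assumes act: "group_action G X \<phi>" and S: "S \<subseteq> carrier G" and g: "g \<in> generate G S"
  shows "\<exists>n. \<forall>x\<in>X. (x, \<phi> g x) \<in> ((adj (schreier X \<phi> S))\<^sup>=) ^^ n"
  using g
proof induction
  case one
  have "(x, \<phi> \<one>\<^bsub>G\<^esub> x) \<in> ((adj (schreier X \<phi> S))\<^sup>=) ^^ 0" if "x \<in> X" for x
    using group_action.id_eq_one[OF act] that by (metis relpow_0_I restrict_apply')
  then show ?case by blast
next
  case (incl h)
  have "(x, \<phi> h x) \<in> ((adj (schreier X \<phi> S))\<^sup>=) ^^ 1" if "x \<in> X" for x
    using that incl by (auto simp: adj_def schreier_def)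
  then show ?case by blast
next
  case (inv h)
  have hc: "h \<in> carrier G" using inv S by auto
  interpret group_action G X \<phi> by (rule act)
  interpret group G using group_hom group_hom.axioms(1) by blast
  have "(x, \<phi> (inv\<^bsub>G\<^esub> h) x) \<in> ((adj (schreier X \<phi> S))\<^sup>=) ^^ 1" if x: "x \<in> X" for x
  proof -
    let ?y = "\<phi> (inv\<^bsub>G\<^esub> h) x"
    have y: "?y \<in> X" using x hc by (meson element_image inv_closed)
    have "\<phi> h ?y = x"
      using orbit_sym_aux[of "inv\<^bsub>G\<^esub> h" x ?y] x hc by simp
    then have "x = ?y \<or> {x, ?y} \<in> schreier X \<phi> S"
      using y inv by (auto simp: schreier_def insert_commute) (metis insert_commute)
    then show ?thesis by (auto simp: adj_def)
  qed
  then show ?case by blast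
next
  case (eng g h)
  then obtain m n where
    m: "\<And>x. x \<in> X \<Longrightarrow> (x, \<phi> g x) \<in> ((adj (schreier X \<phi> S))\<^sup>=) ^^ m" and
    n: "\<And>x. x \<in> X \<Longrightarrow> (x, \<phi> h x) \<in> ((adj (schreier X \<phi> S))\<^sup>=) ^^ n" by blast
  interpret group_action G X \<phi> by (rule act)
  interpret group G using group_hom group_hom.axioms(1) by blast
  have c: "g \<in> carrier G" "h \<in> carrier G" using eng S generate_in_carrier by auto
  have "(x, \<phi> (g \<otimes>\<^bsub>G\<^esub> h) x) \<in> ((adj (schreier X \<phi> S))\<^sup>=) ^^ (n + m)" if x: "x \<in> X" for x
  proof -
    have "\<phi> (g \<otimes>\<^bsub>G\<^esub> h) x = \<phi> g (\<phi> h x)" using composition_rule x c by auto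
    moreover have "\<phi> h x \<in> X" using element_image x c by blast
    ultimately show ?thesis using m n x by (auto simp: relpow_add)
  qed
  then show ?case by blast
qed

lemma schreier_graph_power_le:
  assumes act: "group_action G X \<phi>"
    and S: "finite_generating_set G S" and T: "finite_generating_set G T"
  shows "\<exists>l. graph_power (schreier X \<phi> T) k \<subseteq> graph_power (schreier X \<phi> S) l"
proof -
  let ?R = "(adj (schreier X \<phi> S))\<^sup>="
  have "\<forall>g\<in>T. \<exists>n. \<forall>x\<in>X. (x, \<phi> g x) \<in> ?R ^^ n"
    using generate_moves_bounded[OF act] S T by (auto simp: finite_generating_set_def)
  then obtain n where n: "\<And>g x. g \<in> T \<Longrightarrow> x \<in> X \<Longrightarrow> (x, \<phi> g x) \<in> ?R ^^ n g" by metis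
  define m where "m = Max (insert 0 (n ` T))"
  have fin: "finite T" using T by (simp add: finite_generating_set_def)
  have m: "(x, \<phi> g x) \<in> ?R ^^ m" if "g \<in> T" "x \<in> X" for g x
  proof -
    have "n g \<le> m" unfolding m_def using fin that by (intro Max_ge) auto
    then show ?thesis using n[OF that] relpow_reflcl_mono by blast
  qed
  have sym: "sym (?R ^^ m)"
    using sym_adj[of "schreier X \<phi> S"] by (intro relpow_sym sym_Un sym_Id)
  have "(adj (schreier X \<phi> T))\<^sup>= \<subseteq> ?R ^^ m"
  proof (safe)
    fix x y assume "(x, y) \<in> adj (schreier X \<phi> T)"
    then have "\<exists>g\<in>T. (x \<in> X \<and> y = \<phi> g x) \<or> (y \<in> X \<and> x = \<phi> g y)"
      by (auto simp: adj_def schreier_def doubleton_eq_iff)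
    then show "(x, y) \<in> ?R ^^ m" using m sym by (auto dest: symD)
  next
    fix y show "(y, y) \<in> ?R ^^ m" by (auto simp: relpow_reflcl_le intro!: exI[of _ 0])
  qed
  then have "((adj (schreier X \<phi> T))\<^sup>=) ^^ k \<subseteq> (?R ^^ m) ^^ k" by (rule relpow_subset)
  also have "\<dots> = ?R ^^ (m * k)" by (rule relpow_relpow)
  finally show ?thesis by (intro exI[of _ "m * k"] graph_power_mono)
qed

lemma asi_action_eq:
  assumes "group_action G (space M) \<phi>" and S: "finite_generating_set G S"
  shows "asi_action G M \<phi> = asi M (schreier (space M) \<phi> S)"
proof -
  have T: "finite_generating_set G (SOME S. finite_generating_set G S)"
    using S by (rule someI)
  show ?thesis
    unfolding asi_action_def
    by (intro antisym asi_mono schreier_graph_power_le[OF assms(1)] S T)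
qed

end

theory Submission
  imports Defs
begin

text \<open>
  A paradoxical decomposition of \<open>A\<close> can be iterated, so within bounded distance every finite
  \<open>F \<subseteq> A\<close> has at least \<open>n |F|\<close> neighbours in \<open>A\<close>, with \<open>n\<close> as large as we please.  Cover
  the space by \<open>s + 1\<close> Borel sets whose components are finite and far apart, and match the points
  of these sets with two neighbours each, one set after the other.  On a single component, Hall's
  theorem gives an \<open>n\<close>-fold matching of a neighbourhood of it; as there are only countably many
  candidates up to translation, it can be chosen in a Borel way.  Using only two of the \<open>n\<close> layers,
  and only on the component itself, costs the remaining points at most one unit of expansion:
  a finite set \<open>F\<close> of them loses, for a suitable radius, at most \<open>|F| / n\<close> of its points in an annulus
  around the components, and the rest of \<open>F\<close> splits into parts without common neighbours.  Starting
  with \<open>n = s + 3\<close> one obtains two Borel injections of \<open>A\<close> into itself with disjoint images, and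
  Banach's argument finishes the proof.
\<close>

section \<open>Matchings in expanding graphs\<close>

text \<open>Induction on the size of \<open>L\<close>: a tight proper part \<open>K\<close>, with
  only \<open>card K\<close> neighbours, is matched separately from the rest; if there is none, any
  single pair may be fixed.\<close>

theorem Hall_marriage:
  assumes "finite L" and "\<And>x. x \<in> L \<Longrightarrow> finite (N x)"
    and "\<And>J. J \<subseteq> L \<Longrightarrow> card J \<le> card (\<Union>x\<in>J. N x)"
  shows "\<exists>f. inj_on f L \<and> (\<forall>x\<in>L. f x \<in> N x)"
  using assms
proof (induction "card L" arbitrary: L N rule: less_induct)
  case less
  note fin = less.prems(1,2) and hall = less.prems(3)
  show ?case
  proof (cases "L = {}")
    case False
    show ?thesis
    proof (cases "\<exists>K. K \<noteq> {} \<and> K \<subset> L \<and> card (\<Union>x\<in>K. N x) = card K")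
      case True
      then obtain K where K: "K \<noteq> {}" "K \<subset> L" "card (\<Union>x\<in>K. N x) = card K" by blast
      let ?U = "\<Union>x\<in>K. N x"
      have finK: "finite K" using K(2) fin(1) by (meson finite_subset psubset_imp_subset)
      then have finU: "finite ?U" using K(2) fin(2) by (intro finite_UN_I) auto
      have "card K < card L" using K fin(1) by (simp add: psubset_card_mono)
      then have "\<exists>f. inj_on f K \<and> (\<forall>x\<in>K. f x \<in> N x)"
        using K(2) finK fin hall by (intro less.hyps) auto
      then obtain f where f: "inj_on f K" "\<forall>x\<in>K. f x \<in> N x" by blast
      have "card (L - K) < card L" using K(1,2) fin(1)
        by (intro psubset_card_mono) auto
      \<comment> \<open>Compare with the neighbours of \<open>J \<union> K\<close>, of which those
        of \<open>K\<close> use up only \<open>card K\<close>.\<close>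
      moreover have "card J \<le> card (\<Union>x\<in>J. N x - ?U)" if J: "J \<subseteq> L - K" for J
      proof -
        have finJ: "finite J" using J fin(1) finite_subset by blast
        have "card (J \<union> K) = card J + card K"
          using J finJ finK by (intro card_Un_disjoint) auto
        moreover have "card (J \<union> K) \<le> card (\<Union>x\<in>J \<union> K. N x)" using J K by (intro hall) auto
        moreover have "(\<Union>x\<in>J \<union> K. N x) = (\<Union>x\<in>J. N x - ?U) \<union> ?U" by auto
        moreover have "finite (\<Union>x\<in>J. N x - ?U)" using J finJ fin by auto
        then have "card ((\<Union>x\<in>J. N x - ?U) \<union> ?U) = card (\<Union>x\<in>J. N x - ?U) + card ?U"
          using finU by (intro card_Un_disjoint) auto
        ultimately show ?thesis using K(3) by (simp only: add_le_cancel_right)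
      qed
      ultimately have "\<exists>f. inj_on f (L - K) \<and> (\<forall>x\<in>L - K. f x \<in> N x - ?U)"
        using fin by (intro less.hyps) auto
      then obtain f' where f': "inj_on f' (L - K)" "\<forall>x\<in>L - K. f' x \<in> N x - ?U" by blast
      let ?h = "\<lambda>x. if x \<in> K then f x else f' x"
      have "inj_on ?h (K \<union> (L - K))"
        using f f' by (subst inj_on_disjoint_Un) (auto cong: inj_on_cong)
      then have "inj_on ?h L" using K(2) by (simp add: Un_absorb1 psubset_imp_subset)
      moreover have "\<forall>x\<in>L. ?h x \<in> N x" using f f' by auto
      ultimately show ?thesis by blast
    next
      case no_tight: False
      obtain x where x: "x \<in> L" using False by blast
      have "card {x} \<le> card (\<Union>x\<in>{x}. N x)" using x by (intro hall) auto
      then obtain y where y: "y \<in> N x" by (cases "N x = {}") auto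
      have "card (L - {x}) < card L" using x fin(1) by (meson card_Diff1_less)
      \<comment> \<open>With no tight part, a nonempty \<open>J\<close> has a spare neighbour, so it
        can afford to lose \<open>y\<close>.\<close>
      moreover have "card J \<le> card (\<Union>z\<in>J. N z - {y})" if J: "J \<subseteq> L - {x}" for J
      proof (cases "J = {}")
        case ne: False
        have finJ: "finite (\<Union>z\<in>J. N z)" using J fin finite_subset[of J L] by auto
        have "card (\<Union>z\<in>J. N z) \<noteq> card J" using no_tight J x ne by blast
        then have "card J < card (\<Union>z\<in>J. N z)"
          using hall[of J] J by (simp add: subset_Diff_insert le_neq_implies_less)
        moreover have "(\<Union>z\<in>J. N z - {y}) = (\<Union>z\<in>J. N z) - {y}" by auto
        moreover have "card (\<Union>z\<in>J. N z) \<le> Suc (card ((\<Union>z\<in>J. N z) - {y}))"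
          using card_Diff_singleton_if[of "\<Union>z\<in>J. N z" y] by (cases "card (\<Union>z\<in>J. N z)") auto
        ultimately show ?thesis by (simp only: less_Suc_eq_le[symmetric] less_le_trans)
      qed simp
      ultimately have "\<exists>f. inj_on f (L - {x}) \<and> (\<forall>z\<in>L - {x}. f z \<in> N z - {y})"
        using fin by (intro less.hyps) auto
      then obtain f where f: "inj_on f (L - {x})" "\<forall>z\<in>L - {x}. f z \<in> N z - {y}" by blast
      let ?h = "f(x := y)"
      have "inj_on ?h L" using f by (auto simp: inj_on_def)
      moreover have "\<forall>z\<in>L. ?h z \<in> N z" using f(2) y by simp
      ultimately show ?thesis by blast
    qed
  qed simp
qed

section \<open>Expansion and multiple matchings\<close>

text \<open>Hall's condition for an \<open>n\<close>-fold matching. \<open>L\<close> holds the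
  points still to be matched and \<open>W\<close> the values still free.\<close>

definition expands :: "('a \<times> 'a) set \<Rightarrow> nat \<Rightarrow> 'a set \<Rightarrow> 'a set \<Rightarrow> bool" where
  "expands \<rho> n L W \<longleftrightarrow> (\<forall>F. finite F \<longrightarrow> F \<subseteq> L \<longrightarrow> n * card F \<le> card (\<rho> `` F \<inter> W))"

text \<open>Hall's theorem for \<open>n\<close> copies of every point: any set of copies is at most
  \<open>n\<close> times as large as its projection, to which expansion applies.\<close>

lemma multiple_matching:
  assumes "expands \<rho> n L W" and "finite B" "B \<subseteq> L" and "\<And>x. x \<in> B \<Longrightarrow> finite (\<rho> `` {x})"
  shows "\<exists>h. inj_on (case_prod h) (B \<times> {..<n}) \<and> (\<forall>x\<in>B. \<forall>l<n. (x, h x l) \<in> \<rho> \<and> h x l \<in> W)"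
proof -
  have "\<exists>f. inj_on f (B \<times> {..<n}) \<and> (\<forall>p\<in>B \<times> {..<n}. f p \<in> \<rho> `` {fst p} \<inter> W)"
  proof (rule Hall_marriage)
    fix J assume J: "J \<subseteq> B \<times> {..<n}"
    have "finite J" using J assms(2) by (auto intro: finite_subset)
    have F: "finite (fst ` J)" "fst ` J \<subseteq> B" using J \<open>finite J\<close> by auto
    have "J \<subseteq> fst ` J \<times> {..<n}" using J by force
    then have "card J \<le> card (fst ` J \<times> {..<n})" using F by (intro card_mono) auto
    also have "\<dots> = n * card (fst ` J)" by (simp add: card_cartesian_product)
    also have "\<dots> \<le> card (\<rho> `` (fst ` J) \<inter> W)"
      using assms(1,3) F by (auto simp: expands_def)
    also have "\<rho> `` (fst ` J) \<inter> W = (\<Union>p\<in>J. \<rho> `` {fst p} \<inter> W)" by auto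
    finally show "card J \<le> card (\<Union>p\<in>J. \<rho> `` {fst p} \<inter> W)" .
  qed (use assms in auto)
  then obtain f where "inj_on f (B \<times> {..<n})" "\<forall>p\<in>B \<times> {..<n}. f p \<in> \<rho> `` {fst p} \<inter> W" by blast
  then show ?thesis by (intro exI[of _ "curry f"]) auto
qed

text \<open>Pigeonhole: if every increment exceeded \<open>m / n\<close>, then \<open>u\<close>
  would increase from 0 to \<open>n\<close> by more than \<open>m\<close>. Such increments are
  positive, so truncated subtraction does no harm.\<close>

lemma small_increment:
  fixes u :: "nat \<Rightarrow> nat"
  assumes "u n \<le> m" "0 < n"
  shows "\<exists>j<n. n * (u (Suc j) - u j) \<le> m"
proof (rule ccontr)
  assume *: "\<not> ?thesis"
  have "j \<le> n \<Longrightarrow> j * Suc m \<le> n * u j" for j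
  proof (induction j)
    case (Suc j)
    then have "Suc m \<le> n * (u (Suc j) - u j)" using * by (meson Suc_le_eq linorder_not_le)
    then have "j * Suc m + Suc m \<le> n * u j + n * (u (Suc j) - u j)" using Suc by simp
    moreover have "u j \<le> u (Suc j)"
      using \<open>Suc m \<le> n * (u (Suc j) - u j)\<close> by (cases "u j \<le> u (Suc j)") auto
    then have "n * u j + n * (u (Suc j) - u j) = n * u (Suc j)"
      by (simp add: add_mult_distrib2[symmetric])
    ultimately show ?case by simp
  qed simp
  from this[of n] have "n * Suc m \<le> n * u n" by simp
  then have "Suc m \<le> u n" using assms(2) by (rule mult_left_le_imp_le)
  then show False using assms(1) by simp
qed

lemma relpow_refl_mono:
  assumes "refl \<rho>" "m \<le> n"
  shows "\<rho> ^^ m \<subseteq> \<rho> ^^ n"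
proof -
  have "\<rho>\<^sup>= = \<rho>" using assms(1) by (auto simp: refl_on_def)
  then show ?thesis using relpow_reflcl_mono[OF assms(2), of \<rho>] by simp
qed

lemma relpow_trans: "(x, y) \<in> R ^^ m \<Longrightarrow> (y, z) \<in> R ^^ n \<Longrightarrow> (x, z) \<in> R ^^ (m + n)"
  by (auto simp: relpow_add)

section \<open>The cost of a local matching\<close>

text \<open>
  Each class \<open>C\<close> of \<open>E\<close> has its own matching \<open>h\<close>, defined on the ball of radius \<open>2 n\<close> around \<open>C\<close>.
  A finite \<open>F \<subseteq> L - D\<close> is compared with an \<open>n\<close>-fold matching glued from these near \<open>D\<close> and a
  fresh one away from \<open>D\<close>, after deleting the annulus between the radii \<open>2 j\<close> and \<open>2 j + 2\<close>.
\<close>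

lemma expands_after_local_matching:
  fixes \<rho> :: "('a \<times> 'a) set" and h :: "'a \<Rightarrow> 'a \<Rightarrow> nat \<Rightarrow> 'a"
  assumes \<rho>: "sym \<rho>" "refl \<rho>" and lf: "\<And>x. x \<in> L \<Longrightarrow> finite (\<rho> `` {x})"
    and exp: "expands \<rho> n L W" and n: "0 < n" and d: "d \<le> n" and D: "D \<subseteq> L"
    and E: "equiv D E" and sep: "\<And>x y. \<lbrakk>x \<in> D; y \<in> D; (x, y) \<in> \<rho> ^^ (4 * n)\<rbrakk> \<Longrightarrow> (x, y) \<in> E"
    and h_cong: "\<And>x y. (x, y) \<in> E \<Longrightarrow> h x = h y"
    and h_inj: "\<And>t. t \<in> D \<Longrightarrow> inj_on (case_prod (h t)) (((\<rho> ^^ (2 * n)) `` (E `` {t}) \<inter> L) \<times> {..<n})"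
    and h_mem: "\<And>t x l. \<lbrakk>t \<in> D; x \<in> (\<rho> ^^ (2 * n)) `` (E `` {t}) \<inter> L; l < n\<rbrakk> \<Longrightarrow>
      (x, h t x l) \<in> \<rho> \<and> h t x l \<in> W"
  shows "inj_on (\<lambda>(x, l). h x x l) (D \<times> {..<d})"
    and "expands \<rho> (n - 1) (L - D) (W - (\<Union>l<d. (\<lambda>x. h x x l) ` D))"
proof -
  have symp: "(y, x) \<in> \<rho> ^^ k" if "(x, y) \<in> \<rho> ^^ k" for x y k
    using relpow_sym[OF \<rho>(1)] that by (meson symD)
  have near: "(x, x') \<in> \<rho> ^^ 2" if "(x, y) \<in> \<rho>" "(x', y) \<in> \<rho>" for x x' y
    using that \<rho>(1) by (auto simp: numeral_2_eq_2 sym_def)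
  have reflE: "(x, x) \<in> E" if "x \<in> D" for x using E that by (meson equiv_class_self Image_singleton_iff)
  have self: "x \<in> (\<rho> ^^ (2 * n)) `` (E `` {x}) \<inter> L" if "x \<in> D" for x
  proof -
    have "(x, x) \<in> \<rho> ^^ (2 * n)" using relpow_refl_mono[OF \<rho>(2), of 0 "2 * n"] by auto
    then show ?thesis using reflE that D by blast
  qed
  have symE: "(y, x) \<in> E" if "(x, y) \<in> E" for x y using E that by (meson equivE symD)
  have cls: "E `` {x} = E `` {y}" if "(x, y) \<in> E" for x y using E that by (rule equiv_class_eq)
  have same: "(x, y) \<in> E" if "x \<in> D" "y \<in> D" "(x, y) \<in> \<rho> ^^ k" "k \<le> 4 * n" for x y k
    using sep that relpow_refl_mono[OF \<rho>(2) that(4)] by blast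
  show "inj_on (\<lambda>(x, l). h x x l) (D \<times> {..<d})"
  proof (rule inj_onI, clarify)
    fix x l x' l'
    assume *: "x \<in> D" "x' \<in> D" "l < d" "l' < d" "h x x l = h x' x' l'"
    \<comment> \<open>Equal values force distance 2, which is at most \<open>4 * n\<close>; hence
      both points share a class and one injective matching.\<close>
    have "(x, x') \<in> \<rho> ^^ 2"
      using * h_mem[OF _ self, of x l] h_mem[OF _ self, of x' l'] d by (intro near) auto
    then have e: "(x, x') \<in> E" using same * n by fastforce
    have "x' \<in> (\<rho> ^^ (2 * n)) `` (E `` {x}) \<inter> L" using self[of x'] * cls[OF e] by simp
    then have "(x, l) = (x', l')"
      using h_inj[of x] * h_cong[OF e] self[of x] d by (intro inj_onD[of "case_prod (h x)"]) auto
    then show "x = x' \<and> l = l'" by simp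
  qed
  let ?M = "\<Union>l<d. (\<lambda>x. h x x l) ` D"
  show "expands \<rho> (n - 1) (L - D) (W - ?M)"
    unfolding expands_def
  proof (intro allI impI)
    fix F assume F: "finite F" "F \<subseteq> L - D"
    \<comment> \<open>Annuli of width 2 around \<open>D\<close>: some increment of \<open>u\<close>
      among the first \<open>n\<close> is at most \<open>card F / n\<close>.\<close>
    define u where "u j = card (F \<inter> (\<rho> ^^ (2 * j)) `` D)" for j
    have "u n \<le> card F" unfolding u_def using F by (intro card_mono) auto
    then obtain j where j: "j < n" "n * (u (Suc j) - u j) \<le> card F"
      using small_increment n by blast
    define I where "I = F \<inter> (\<rho> ^^ (2 * j)) `` D"
    define Out where "Out = F - (\<rho> ^^ (2 * Suc j)) `` D"
    have fin: "finite I" "finite Out" using F by (auto simp: I_def Out_def)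
    have sub: "I \<subseteq> F \<inter> (\<rho> ^^ (2 * Suc j)) `` D"
      unfolding I_def using relpow_refl_mono[OF \<rho>(2), of "2 * j" "2 * Suc j"] by auto
    have dis: "I \<inter> Out = {}" using sub by (auto simp: Out_def)
    have cF: "card F = card Out + u (Suc j)"
      unfolding Out_def u_def using F by (subst card_Un_disjoint[symmetric]) (auto intro: arg_cong[where f = card])
    have cI: "card I = u j" by (simp add: I_def u_def)
    have "u j \<le> u (Suc j)"
      unfolding u_def by (rule card_mono[OF _ sub[unfolded I_def]]) (use F in simp)
    then have "n * card F = n * (card I + card Out) + n * (u (Suc j) - u j)"
      unfolding cF cI by (simp add: add_mult_distrib2[symmetric])
    \<comment> \<open>Dropping the annulus costs at most \<open>card F\<close> of the
      \<open>n * card F\<close> values.\<close>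
    then have main: "(n - 1) * card F \<le> n * (card I + card Out)"
      using j(2) by (simp add: diff_mult_distrib)
    \<comment> \<open>An inner point uses the matching of the class of a nearby \<open>t x\<close>;
      the outer points get the fresh matching \<open>k\<close>.\<close>
    have "\<forall>x\<in>I. \<exists>t. t \<in> D \<and> (t, x) \<in> \<rho> ^^ (2 * j)" by (auto simp: I_def)
    then obtain t where t: "\<And>x. x \<in> I \<Longrightarrow> t x \<in> D" "\<And>x. x \<in> I \<Longrightarrow> (t x, x) \<in> \<rho> ^^ (2 * j)" by metis
    have "Out \<subseteq> L" using F by (auto simp: Out_def)
    then obtain k where k: "inj_on (case_prod k) (Out \<times> {..<n})"
      "\<And>x l. x \<in> Out \<Longrightarrow> l < n \<Longrightarrow> (x, k x l) \<in> \<rho> \<and> k x l \<in> W"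
      using multiple_matching[OF exp fin(2)] lf by (metis subsetD)
    define \<theta> where "\<theta> = (\<lambda>(x, l). if x \<in> I then h (t x) x l else k x l)"
    have inball: "x \<in> (\<rho> ^^ (2 * n)) `` (E `` {t x}) \<inter> L" if x: "x \<in> I" for x
      using t[OF x] reflE[OF t(1)[OF x]] relpow_refl_mono[OF \<rho>(2), of "2 * j" "2 * n"] j(1) x F(2)
      by (auto simp: I_def)
    have \<theta>_mem: "(x, \<theta> (x, l)) \<in> \<rho> \<and> \<theta> (x, l) \<in> W" if "x \<in> I \<union> Out" "l < n" for x l
      using that h_mem[OF t(1) inball] k(2) by (auto simp: \<theta>_def)
    have far: "(y, x) \<notin> \<rho> ^^ k" if "x \<in> Out" "y \<in> D" "k \<le> 2 * Suc j" for x y k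
      using that relpow_refl_mono[OF \<rho>(2), of k "2 * Suc j"] by (auto simp: Out_def)
    \<comment> \<open>A common neighbour would put \<open>x'\<close> within \<open>2 * j + 2\<close>
      of \<open>D\<close>, which is why the annuli have width 2.\<close>
    have apart: "(x, x') \<notin> \<rho> ^^ 2" if "x \<in> I" "x' \<in> Out" for x x'
      using far[OF that(2) t(1)[OF that(1)], of "2 * j + 2"] relpow_trans[OF t(2)[OF that(1)], of x' 2]
      by auto
    \<comment> \<open>The path through \<open>x\<close> and \<open>x'\<close> has length
      \<open>4 * j + 2\<close>, below \<open>4 * n\<close> because \<open>j < n\<close>.\<close>
    have close: "(t x, t x') \<in> E" if "x \<in> I" "x' \<in> I" "(x, x') \<in> \<rho> ^^ 2" for x x'
      using same[OF t(1) t(1) relpow_trans[OF t(2) relpow_trans[OF that(3) symp[OF t(2)]]]] that j(1)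
      by simp
    have "inj_on \<theta> ((I \<union> Out) \<times> {..<n})"
    proof (rule inj_onI)
      fix p q assume pq: "p \<in> (I \<union> Out) \<times> {..<n}" "q \<in> (I \<union> Out) \<times> {..<n}" "\<theta> p = \<theta> q"
      obtain x l x' l' where [simp]: "p = (x, l)" "q = (x', l')" by (cases p, cases q)
      have nr: "(x, x') \<in> \<rho> ^^ 2" using pq \<theta>_mem[of x l] \<theta>_mem[of x' l'] by (intro near) auto
      consider "x \<in> I" "x' \<in> I" | "x \<in> I" "x' \<in> Out" | "x \<in> Out" "x' \<in> I" | "x \<in> Out" "x' \<in> Out"
        using pq by auto
      then show "p = q"
      proof cases
        case 1
        have e: "(t x, t x') \<in> E" using close 1 nr by blast
        have "x' \<in> (\<rho> ^^ (2 * n)) `` (E `` {t x}) \<inter> L" using inball[of x'] 1 cls[OF e] by simp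
        then show ?thesis
          using h_inj[of "t x"] pq h_cong[OF e] inball[of x] 1 t
          by (intro inj_onD[of "case_prod (h (t x))"]) (auto simp: \<theta>_def)
      next
        case 4
        then have "x \<notin> I" "x' \<notin> I" using dis by auto
        then show ?thesis using 4 k(1) pq by (intro inj_onD[OF k(1)]) (auto simp: \<theta>_def)
      qed (use apart nr symp[OF nr] in blast)+
    qed
    then have cd: "card (\<theta> ` ((I \<union> Out) \<times> {..<n})) = n * (card I + card Out)"
      using fin dis by (simp add: card_image card_cartesian_product card_Un_disjoint)
    have im: "\<theta> ` ((I \<union> Out) \<times> {..<n}) \<subseteq> \<rho> `` F \<inter> (W - ?M)"
    proof clarify
      fix x l assume x: "x \<in> I \<union> Out" "l < n"
      \<comment> \<open>A value used at \<open>y\<close> in \<open>D\<close> would put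
        \<open>x\<close> within distance 2 of \<open>y\<close>, so \<open>x\<close> is inner and
        follows the matching of the class of \<open>y\<close>. Injectivity gives
        \<open>x = y\<close>, but \<open>F\<close> avoids \<open>D\<close>.\<close>
      have "\<theta> (x, l) \<notin> ?M"
      proof
        assume "\<theta> (x, l) \<in> ?M"
        then obtain y i where y: "y \<in> D" "i < d" "\<theta> (x, l) = h y y i" by auto
        have nr: "(y, x) \<in> \<rho> ^^ 2"
          using \<theta>_mem[OF x] y h_mem[OF y(1) self, of i] d by (intro near) auto
        have "x \<notin> Out" using far[OF _ y(1), of x 2] nr by auto
        then have xI: "x \<in> I" using x by auto
        have e: "(y, t x) \<in> E"
          using same[OF y(1) t(1) relpow_trans[OF nr symp[OF t(2)]]] xI j(1) by simp
        have "(x, l) = (y, i)"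
          using h_inj[of y] y x h_cong[OF e] inball[OF xI] xI self[of y] cls[OF e] d
          by (intro inj_onD[of "case_prod (h y)"]) (auto simp: \<theta>_def)
        then show False using xI y F by (auto simp: I_def)
      qed
      moreover have "x \<in> F" using x by (auto simp: I_def Out_def)
      ultimately show "\<theta> (x, l) \<in> \<rho> `` F \<inter> (W - ?M)" using \<theta>_mem[OF x] by auto
    qed
    have "finite (\<rho> `` F)"
      unfolding Image_eq_UN[of \<rho> F] using F lf by (intro finite_UN_I) auto
    then have "n * (card I + card Out) \<le> card (\<rho> `` F \<inter> (W - ?M))"
      unfolding cd[symmetric] by (intro card_mono im finite_Int disjI1)
    then show "(n - 1) * card F \<le> card (\<rho> `` F \<inter> (W - ?M))" using main by linarith
  qed
qed

section \<open>Borel choices along orbits\<close>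

lemma pred_cong:
  assumes "\<And>x. x \<in> space N \<Longrightarrow> P x \<longleftrightarrow> Q x" and "Measurable.pred N Q"
  shows "Measurable.pred N P"
  using assms(2) by (subst measurable_cong[of N P Q]) (rule assms(1))

text \<open>
  The maps \<open>g i\<close> enumerate the action of a countable group, so quantifiers over an orbit become
  quantifiers over \<open>nat\<close>.  The sets \<open>V m\<close> separate points, and \<open>\<rho>\<close> is a bounded distance relation.
\<close>

locale borel_graph =
  fixes M :: "'a measure" and g :: "nat \<Rightarrow> 'a \<Rightarrow> 'a" and V :: "nat \<Rightarrow> 'a set"
    and \<rho> :: "('a \<times> 'a) set" and I :: "nat set"
  assumes g_measurable [measurable]: "g i \<in> measurable M M"
    and g_comp: "\<exists>k. \<forall>x\<in>space M. g i (g j x) = g k x"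
    and g_left_inv: "\<exists>j. \<forall>x\<in>space M. g j (g i x) = x"
    and V_sets [measurable]: "V m \<in> sets M"
    and V_sep: "\<lbrakk>finite F; F \<subseteq> space M; x \<in> F\<rbrakk> \<Longrightarrow> \<exists>m. V m \<inter> F = {x}"
    and sym_\<rho>: "sym \<rho>" and refl_\<rho>: "refl \<rho>" and finite_I: "finite I"
    and \<rho>_iff: "x \<in> space M \<Longrightarrow> (x, y) \<in> \<rho> \<longleftrightarrow> (\<exists>i\<in>I. y = g i x)"
begin

lemma g_space: "x \<in> space M \<Longrightarrow> g i x \<in> space M"
  using measurable_space[OF g_measurable] .

lemma g_ident: obtains i where "\<And>x. x \<in> space M \<Longrightarrow> g i x = x"
proof -
  obtain j where j: "\<forall>x\<in>space M. g j (g 0 x) = x" using g_left_inv by blast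
  obtain k where "\<forall>x\<in>space M. g j (g 0 x) = g k x" using g_comp by blast
  then show thesis using j that by metis
qed

lemma g_inverse:
  obtains j where "\<And>x. x \<in> space M \<Longrightarrow> g j (g i x) = x" "\<And>x. x \<in> space M \<Longrightarrow> g i (g j x) = x"
proof -
  obtain j where j: "\<forall>x\<in>space M. g j (g i x) = x" using g_left_inv by blast
  obtain k where k: "\<forall>x\<in>space M. g k (g j x) = x" using g_left_inv by blast
  have "g k x = g i x" if "x \<in> space M" for x
    using j k g_space[OF that] that by metis
  then show thesis using j k g_space that by metis
qed

text \<open>Equality is a countable condition, because the sets \<open>V m\<close> separate
  points.\<close>

lemma pred_eq [measurable (raw)]:
  assumes [measurable]: "f \<in> measurable N M" "f' \<in> measurable N M"
  shows "Measurable.pred N (\<lambda>x. f x = f' x)"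
proof -
  have "f x = f' x \<longleftrightarrow> (\<forall>m. f x \<in> V m \<longleftrightarrow> f' x \<in> V m)" if x: "x \<in> space N" for x
  proof
    assume *: "\<forall>m. f x \<in> V m \<longleftrightarrow> f' x \<in> V m"
    have "{f x, f' x} \<subseteq> space M" using measurable_space[OF assms(1) x] measurable_space[OF assms(2) x] by simp
    then obtain m where m: "V m \<inter> {f x, f' x} = {f x}" using V_sep[of "{f x, f' x}" "f x"] by auto
    then have "f x \<in> V m" by blast
    then have "f' x \<in> V m \<inter> {f x, f' x}" using * by blast
    then show "f x = f' x" unfolding m by simp
  qed simp
  moreover have "Measurable.pred N (\<lambda>x. \<forall>m. f x \<in> V m \<longleftrightarrow> f' x \<in> V m)" by measurable
  ultimately show ?thesis by (rule pred_cong)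
qed

section \<open>Borel relations inside orbits\<close>

text \<open>Borelness is tested by predicates on \<open>M\<close>, one for each pair of indices,
  which avoids the product space.\<close>

definition orbit_rel :: "('a \<times> 'a) set \<Rightarrow> bool" where
  "orbit_rel r \<longleftrightarrow> (\<forall>x\<in>space M. \<forall>y. (x, y) \<in> r \<longrightarrow> (\<exists>i. y = g i x)) \<and>
     (\<forall>i j. Measurable.pred M (\<lambda>x. (g i x, g j x) \<in> r))"

lemma orbit_relD: "orbit_rel r \<Longrightarrow> (x, y) \<in> r \<Longrightarrow> x \<in> space M \<Longrightarrow> \<exists>i. y = g i x"
  by (auto simp: orbit_rel_def)

lemma orbit_rel_measurable: "orbit_rel r \<Longrightarrow> Measurable.pred M (\<lambda>x. (g i x, g j x) \<in> r)"
  by (auto simp: orbit_rel_def)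

lemma orbit_rel_measurable_id:
  assumes "orbit_rel r"
  shows "Measurable.pred M (\<lambda>x. (x, g j x) \<in> r)"
proof -
  obtain i where i: "\<And>x. x \<in> space M \<Longrightarrow> g i x = x" using g_ident by blast
  show ?thesis by (rule pred_cong[OF _ orbit_rel_measurable[OF assms, of i j]]) (simp add: i)
qed

lemma orbit_relI:
  assumes "\<And>x y. x \<in> space M \<Longrightarrow> (x, y) \<in> r \<longleftrightarrow> (\<exists>i. y = g i x \<and> P i)"
  shows "orbit_rel r"
  unfolding orbit_rel_def
proof (intro conjI allI)
  fix i j
  have "Measurable.pred M (\<lambda>x. \<exists>k. g j x = g k (g i x) \<and> P k)" by measurable
  then show "Measurable.pred M (\<lambda>x. (g i x, g j x) \<in> r)"
    by (rule pred_cong[rotated]) (simp add: assms g_space)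
qed (use assms in auto)

lemma orbit_rel_\<rho>: "orbit_rel \<rho>"
  by (rule orbit_relI[where P = "\<lambda>i. i \<in> I"]) (auto simp: \<rho>_iff)

lemma orbit_rel_Id: "orbit_rel Id"
proof -
  obtain e where e: "\<And>x. x \<in> space M \<Longrightarrow> g e x = x" using g_ident by blast
  show ?thesis by (rule orbit_relI[where P = "\<lambda>i. i = e"]) (auto simp: e)
qed

text \<open>The midpoint lies in the same orbit, so it can be quantified by its index.\<close>

lemma orbit_rel_comp:
  assumes r: "orbit_rel r" and s: "orbit_rel s"
  shows "orbit_rel (r O s)"
  unfolding orbit_rel_def
proof (intro conjI ballI allI impI)
  fix x y assume x: "x \<in> space M" and "(x, y) \<in> r O s"
  then obtain z where z: "(x, z) \<in> r" "(z, y) \<in> s" by blast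
  obtain i where i: "z = g i x" using orbit_relD[OF r z(1) x] by blast
  obtain j where "y = g j z" using orbit_relD[OF s z(2)] g_space[OF x] i by blast
  then show "\<exists>k. y = g k x" using i g_comp[of j i] x by metis
next
  fix i j
  have "(g i x, g j x) \<in> r O s \<longleftrightarrow> (\<exists>m. (g i x, g m x) \<in> r \<and> (g m x, g j x) \<in> s)"
    if x: "x \<in> space M" for x
  proof -
    have "\<exists>m. z = g m x" if "(g i x, z) \<in> r" for z
      using orbit_relD[OF r that] g_space[OF x] g_comp[of _ i] x by metis
    then show ?thesis by blast
  qed
  moreover have "Measurable.pred M (\<lambda>x. \<exists>m. (g i x, g m x) \<in> r \<and> (g m x, g j x) \<in> s)"
    using orbit_rel_measurable[OF r] orbit_rel_measurable[OF s] by measurable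
  ultimately show "Measurable.pred M (\<lambda>x. (g i x, g j x) \<in> r O s)"
    by (rule pred_cong)
qed

lemma orbit_rel_relpow: "orbit_rel r \<Longrightarrow> orbit_rel (r ^^ n)"
  by (induction n) (auto simp: orbit_rel_Id intro: orbit_rel_comp)

lemma orbit_rel_rtrancl:
  assumes r: "orbit_rel r"
  shows "orbit_rel (r\<^sup>*)"
  unfolding orbit_rel_def rtrancl_power
proof (intro conjI ballI allI impI)
  fix x y assume "x \<in> space M" "\<exists>n. (x, y) \<in> r ^^ n"
  then show "\<exists>k. y = g k x" using orbit_relD[OF orbit_rel_relpow[OF r]] by blast
next
  fix i j
  show "Measurable.pred M (\<lambda>x. \<exists>n. (g i x, g j x) \<in> r ^^ n)"
    using orbit_rel_measurable[OF orbit_rel_relpow[OF r]] by measurable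
qed

lemma orbit_rel_restrict:
  assumes r: "orbit_rel r" and [measurable]: "D \<in> sets M"
  shows "orbit_rel (r \<inter> D \<times> D)"
  unfolding orbit_rel_def
proof (intro conjI ballI allI impI)
  fix x y assume "x \<in> space M" "(x, y) \<in> r \<inter> D \<times> D"
  then show "\<exists>k. y = g k x" using orbit_relD[OF r] by blast
next
  fix i j
  have [measurable]: "Measurable.pred M (\<lambda>x. (g i x, g j x) \<in> r)" by (rule orbit_rel_measurable[OF r])
  have "Measurable.pred M (\<lambda>x. (g i x, g j x) \<in> r \<and> g i x \<in> D \<and> g j x \<in> D)" by measurable
  then show "Measurable.pred M (\<lambda>x. (g i x, g j x) \<in> r \<inter> D \<times> D)" by simp
qed

lemma finite_relpow_Image:
  assumes "x \<in> space M"
  shows "finite ((\<rho> ^^ n) `` {x}) \<and> (\<rho> ^^ n) `` {x} \<subseteq> space M"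
proof (induction n)
  case 0
  then show ?case using assms by auto
next
  case (Suc n)
  have "\<rho> `` {y} = (\<lambda>i. g i y) ` I" if "y \<in> space M" for y using that by (auto simp: \<rho>_iff)
  then have "finite (\<rho> `` {y}) \<and> \<rho> `` {y} \<subseteq> space M" if "y \<in> space M" for y
    using that finite_I g_space by auto
  moreover have "(\<rho> ^^ Suc n) `` {x} = (\<Union>y\<in>(\<rho> ^^ n) `` {x}. \<rho> `` {y})" by auto
  ultimately show ?case using Suc by (auto simp del: relpow.simps)
qed

lemma finite_\<rho>_Image: "x \<in> space M \<Longrightarrow> finite (\<rho> `` {x})"
  using finite_relpow_Image[of x 1] by simp

section \<open>Borel transversals\<close>

text \<open>The transversal takes from each class the point isolated in it by the first possible \<open>V m\<close>.\<close>

lemma transversal_exists: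
  assumes D [measurable]: "D \<in> sets M" and eq: "equiv D E" and E: "orbit_rel E"
    and fin: "\<And>x. x \<in> D \<Longrightarrow> finite (E `` {x})"
  shows "\<exists>T\<in>sets M. T \<subseteq> D \<and> (\<forall>x\<in>D. \<exists>!t. t \<in> T \<and> (x, t) \<in> E)"
proof -
  define single where "single m x \<longleftrightarrow> (\<exists>!y. (x, y) \<in> E \<and> y \<in> V m)" for m x
  define T where "T = {x \<in> space M. x \<in> D \<and> (\<exists>m. x \<in> V m \<and> single m x \<and> (\<forall>m'<m. \<not> single m' x))}"
  have DM: "D \<subseteq> space M" using D sets.sets_into_space by blast
  have [measurable]: "Measurable.pred M (\<lambda>x. (x, g j x) \<in> E)" for j
    by (rule orbit_rel_measurable_id[OF E])
  have [measurable]: "Measurable.pred M (single m)" for m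
  proof -
    \<comment> \<open>Unique existence becomes existence and uniqueness over indices, which are
      countable conditions.\<close>
    have "single m x \<longleftrightarrow> (\<exists>j. (x, g j x) \<in> E \<and> g j x \<in> V m) \<and>
        (\<forall>i j. (x, g i x) \<in> E \<and> (x, g j x) \<in> E \<and> g i x \<in> V m \<and> g j x \<in> V m \<longrightarrow> g i x = g j x)"
      if "x \<in> space M" for x
    proof -
      have orb: "\<exists>j. y = g j x" if "(x, y) \<in> E" for y
        using orbit_relD[OF E that \<open>x \<in> space M\<close>] .
      have "single m x \<longleftrightarrow> (\<exists>y. (x, y) \<in> E \<and> y \<in> V m) \<and>
          (\<forall>y z. (x, y) \<in> E \<and> (x, z) \<in> E \<and> y \<in> V m \<and> z \<in> V m \<longrightarrow> y = z)"
        unfolding single_def by blast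
      moreover have "(\<exists>y. (x, y) \<in> E \<and> Q y) \<longleftrightarrow> (\<exists>j. (x, g j x) \<in> E \<and> Q (g j x))" for Q
        using orb by metis
      moreover have "(\<forall>y z. (x, y) \<in> E \<and> (x, z) \<in> E \<and> y \<in> V m \<and> z \<in> V m \<longrightarrow> y = z) \<longleftrightarrow>
          (\<forall>i j. (x, g i x) \<in> E \<and> (x, g j x) \<in> E \<and> g i x \<in> V m \<and> g j x \<in> V m \<longrightarrow> g i x = g j x)"
        (is "_ \<longleftrightarrow> ?R")
      proof
        assume R: ?R
        show "\<forall>y z. (x, y) \<in> E \<and> (x, z) \<in> E \<and> y \<in> V m \<and> z \<in> V m \<longrightarrow> y = z"
        proof (intro allI impI, elim conjE)
          fix y z assume yz: "(x, y) \<in> E" "(x, z) \<in> E" "y \<in> V m" "z \<in> V m"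
          obtain i j where "y = g i x" "z = g j x" using orb yz by blast
          then show "y = z" using R yz by blast
        qed
      qed simp
      ultimately show ?thesis by (simp only:)
    qed
    moreover have "Measurable.pred M (\<lambda>x. (\<exists>j. (x, g j x) \<in> E \<and> g j x \<in> V m) \<and>
        (\<forall>i j. (x, g i x) \<in> E \<and> (x, g j x) \<in> E \<and> g i x \<in> V m \<and> g j x \<in> V m \<longrightarrow> g i x = g j x))"
      by measurable
    ultimately show ?thesis by (rule pred_cong)
  qed
  have "T \<in> sets M" unfolding T_def by measurable
  moreover have "\<exists>!t. t \<in> T \<and> (x, t) \<in> E" if x: "x \<in> D" for x
  proof -
    \<comment> \<open>All members of a class agree on which \<open>V m\<close> isolate a point of
      it, hence on the first such \<open>m\<close>.\<close>
    have inv: "single m t = single m x" if "(x, t) \<in> E" for m t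
    proof -
      have "E `` {x} = E `` {t}" using eq that by (rule equiv_class_eq)
      then have "(t, y) \<in> E \<longleftrightarrow> (x, y) \<in> E" for y by blast
      then show ?thesis by (simp add: single_def)
    qed
    have sub: "E `` {x} \<subseteq> D" using eq by (auto dest: equiv_type)
    have "x \<in> E `` {x}" using eq x by (rule equiv_class_self)
    \<comment> \<open>Finiteness of the class provides some \<open>V m\<close> that isolates
      \<open>x\<close>.\<close>
    then obtain m where "V m \<inter> E `` {x} = {x}" using V_sep[OF fin[OF x]] sub DM by blast
    then have "y \<in> V m \<and> (x, y) \<in> E \<longleftrightarrow> y = x" for y by (simp add: set_eq_iff)
    then have "single m x" unfolding single_def by metis
    then have L: "single (LEAST m. single m x) x" by (rule LeastI)
    then obtain y where y: "(x, y) \<in> E" "y \<in> V (LEAST m. single m x)" unfolding single_def by blast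
    have "y \<in> T"
      unfolding T_def using y sub DM L inv[OF y(1)] not_less_Least by blast
    moreover have "t = y" if t: "t \<in> T" "(x, t) \<in> E" for t
    proof -
      obtain m where m: "t \<in> V m" "single m x" "\<forall>m'<m. \<not> single m' x"
        using t inv[OF t(2)] by (auto simp: T_def)
      then have "m = (LEAST m. single m x)" by (metis LeastI Least_le le_less_linear order_antisym)
      then show ?thesis using L y t m(1) unfolding single_def by blast
    qed
    ultimately show ?thesis using y(1) by blast
  qed
  moreover have "T \<subseteq> D" by (auto simp: T_def)
  ultimately show ?thesis by (intro bexI[of _ T] conjI ballI)
qed

section \<open>Borel maps along orbits\<close>

text \<open>For maps that move points along orbits this says that they are Borel, in terms of the
  pieces on which they agree with a fixed move.\<close>

definition orbit_map :: "'a set \<Rightarrow> ('a \<Rightarrow> 'a) \<Rightarrow> bool" where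
  "orbit_map D f \<longleftrightarrow> (\<forall>j. {x \<in> D. f x = g j x} \<in> sets M)"

definition borel_matching :: "nat \<Rightarrow> 'a set \<Rightarrow> 'a set \<Rightarrow> (nat \<Rightarrow> 'a \<Rightarrow> 'a) \<Rightarrow> bool" where
  "borel_matching d D W f \<longleftrightarrow> (\<forall>l<d. orbit_map D (f l)) \<and>
     (\<forall>x\<in>D. \<forall>l<d. (x, f l x) \<in> \<rho> \<and> f l x \<in> W) \<and> inj_on (\<lambda>(x, l). f l x) (D \<times> {..<d})"

lemma image_g_sets:
  assumes [measurable]: "B \<in> sets M"
  shows "g i ` B \<in> sets M"
proof -
  obtain j where j: "\<And>x. x \<in> space M \<Longrightarrow> g j (g i x) = x" "\<And>x. x \<in> space M \<Longrightarrow> g i (g j x) = x"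
    using g_inverse by blast
  have "g i ` B = {y \<in> space M. g j y \<in> B}"
    using j g_space sets.sets_into_space[OF assms] by (auto simp: image_iff) (metis subsetD)+
  also have "\<dots> \<in> sets M" by measurable
  finally show ?thesis .
qed

lemma orbit_map_subset:
  assumes "orbit_map D f" "B \<in> sets M" "B \<subseteq> D"
  shows "orbit_map B f"
proof -
  have "{x \<in> B. f x = g j x} = {x \<in> D. f x = g j x} \<inter> B" for j using assms by auto
  then show ?thesis using assms by (auto simp: orbit_map_def)
qed

text \<open>Borel images can fail to be Borel, but this one is a countable union of translates of
  Borel pieces, each a preimage under an inverse move.\<close>

lemma orbit_map_image:
  assumes f: "orbit_map D f" and \<rho>: "\<And>x. x \<in> D \<Longrightarrow> (x, f x) \<in> \<rho>" and D: "D \<subseteq> space M"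
  shows "f ` D \<in> sets M"
proof -
  have "\<exists>i. f x = g i x" if "x \<in> D" for x using \<rho>[OF that] D that \<rho>_iff by blast
  then have "f ` D = (\<Union>i. g i ` {x \<in> D. f x = g i x})"
    by (force simp: image_iff)
  also have "\<dots> \<in> sets M" using f by (intro sets.countable_UN image_subsetI image_g_sets) (auto simp: orbit_map_def)
  finally show ?thesis .
qed

lemma orbit_map_If:
  assumes "orbit_map D f" "orbit_map D' f'" "D \<inter> S = D" "D' \<inter> S = {}"
  shows "orbit_map (D \<union> D') (\<lambda>x. if x \<in> S then f x else f' x)"
proof -
  have "{x \<in> D \<union> D'. (if x \<in> S then f x else f' x) = g j x} =
      {x \<in> D. f x = g j x} \<union> {x \<in> D'. f' x = g j x}" for j using assms(3,4) by auto
  then show ?thesis using assms(1,2) by (simp add: orbit_map_def)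
qed

section \<open>Codes for finite matchings\<close>

text \<open>
  Seen from \<open>t\<close>, an entry \<open>(i, l, p)\<close> of the list \<open>w\<close> says that layer \<open>l\<close> sends \<open>g i t\<close> to
  \<open>g p t\<close>.  Matchings of finite sets in the orbit of \<open>t\<close> thus have countably many codes.
\<close>

definition codes_matching :: "('a \<times> 'a) set \<Rightarrow> nat \<Rightarrow> 'a set \<Rightarrow> 'a set \<Rightarrow> 'a \<Rightarrow> (nat \<times> nat \<times> nat) list \<Rightarrow> bool" where
  "codes_matching Q n L W t w \<longleftrightarrow>
     (\<forall>i l. (t, g i t) \<in> Q \<and> g i t \<in> L \<and> l < n \<longrightarrow> (\<exists>i' p. (i', l, p) \<in> set w \<and> g i' t = g i t)) \<and>
     (\<forall>i l p. (i, l, p) \<in> set w \<longrightarrow> (g i t, g p t) \<in> \<rho> \<and> g p t \<in> W) \<and>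
     (\<forall>i l p i' l' p'. (i, l, p) \<in> set w \<and> (i', l', p') \<in> set w \<longrightarrow>
        (g p t = g p' t \<longleftrightarrow> g i t = g i' t \<and> l = l'))"

lemma codes_matching_measurable:
  assumes Q: "orbit_rel Q" and [measurable]: "L \<in> sets M" "W \<in> sets M"
  shows "Measurable.pred M (\<lambda>t. codes_matching Q n L W t w)"
proof -
  have [measurable]: "Measurable.pred M (\<lambda>t. (t, g i t) \<in> Q)" for i
    by (rule orbit_rel_measurable_id[OF Q])
  have [measurable]: "Measurable.pred M (\<lambda>t. (g i t, g p t) \<in> \<rho>)" for i p
    by (rule orbit_rel_measurable[OF orbit_rel_\<rho>])
  show ?thesis unfolding codes_matching_def by measurable
qed

text \<open>Hall's theorem matches the finitely many relevant points. They and their values lie in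
  the orbit of \<open>t\<close>, so their indices can be listed.\<close>

lemma codes_matching_exists:
  assumes Q: "orbit_rel Q" and t: "t \<in> space M" and fin: "finite (Q `` {t})"
    and exp: "expands \<rho> n L W" and L: "L \<subseteq> space M"
  shows "\<exists>w. codes_matching Q n L W t w"
proof -
  let ?B = "Q `` {t} \<inter> L"
  obtain h where h: "inj_on (case_prod h) (?B \<times> {..<n})"
    "\<And>x l. x \<in> ?B \<Longrightarrow> l < n \<Longrightarrow> (x, h x l) \<in> \<rho> \<and> h x l \<in> W"
    using multiple_matching[OF exp, of ?B] fin L finite_\<rho>_Image by blast
  have "\<exists>i. x = g i t" if "x \<in> ?B" for x using orbit_relD[OF Q _ t] that by blast
  then obtain \<iota> where \<iota>: "\<And>x. x \<in> ?B \<Longrightarrow> g (\<iota> x) t = x" by metis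
  have "\<exists>p. h x l = g p t" if x: "x \<in> ?B" "l < n" for x l
  proof -
    have "(t, h x l) \<in> Q O \<rho>" using h(2)[OF x] x by blast
    then show ?thesis using orbit_relD[OF orbit_rel_comp[OF Q orbit_rel_\<rho>] _ t] by blast
  qed
  then obtain \<pi> where \<pi>: "\<And>x l. x \<in> ?B \<Longrightarrow> l < n \<Longrightarrow> g (\<pi> x l) t = h x l" by metis
  have "finite ((\<lambda>(x, l). (\<iota> x, l, \<pi> x l)) ` (?B \<times> {..<n}))" using fin by simp
  then obtain w where w: "set w = (\<lambda>(x, l). (\<iota> x, l, \<pi> x l)) ` (?B \<times> {..<n})"
    using finite_list by blast
  have wD: "\<exists>x\<in>?B. i = \<iota> x \<and> l < n \<and> p = \<pi> x l \<and> g i t = x \<and> g p t = h x l"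
    if "(i, l, p) \<in> set w" for i l p
    using that \<iota> \<pi> unfolding w by auto
  have "codes_matching Q n L W t w"
    unfolding codes_matching_def
  proof (intro conjI allI impI)
    fix i l assume il: "(t, g i t) \<in> Q \<and> g i t \<in> L \<and> l < n"
    then have "(\<iota> (g i t), l, \<pi> (g i t) l) \<in> set w" unfolding w by auto
    then show "\<exists>i' p. (i', l, p) \<in> set w \<and> g i' t = g i t" using \<iota>[of "g i t"] il by blast
  next
    fix i l p assume "(i, l, p) \<in> set w"
    then obtain x where x: "x \<in> ?B" "l < n" "g i t = x" "g p t = h x l" using wD by blast
    then show "(g i t, g p t) \<in> \<rho>" "g p t \<in> W" using h(2)[OF x(1,2)] by simp_all
  next
    fix i l p i' l' p' assume *: "(i, l, p) \<in> set w \<and> (i', l', p') \<in> set w"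
    obtain x where x: "x \<in> ?B" "l < n" "g i t = x" "g p t = h x l" using wD * by blast
    obtain x' where x': "x' \<in> ?B" "l' < n" "g i' t = x'" "g p' t = h x' l'" using wD * by blast
    have "h x l = h x' l' \<longleftrightarrow> (x, l) = (x', l')"
      using inj_on_eq_iff[OF h(1), of "(x, l)" "(x', l')"] x x' by simp
    then show "g p t = g p' t \<longleftrightarrow> g i t = g i' t \<and> l = l'" using x x' by simp
  qed
  then show ?thesis by blast
qed

text \<open>A point may have several indices, but a valid code leaves only one value to choose;
  without an entry the value is arbitrary.\<close>

definition decode :: "'a \<Rightarrow> (nat \<times> nat \<times> nat) list \<Rightarrow> 'a \<Rightarrow> nat \<Rightarrow> 'a" where
  "decode t w x l = (SOME y. \<exists>i p. (i, l, p) \<in> set w \<and> x = g i t \<and> y = g p t)"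

text \<open>The first clause of \<open>codes_matching\<close> supplies an entry; the third one, read
  from right to left, makes its value unique.\<close>

lemma decode:
  assumes w: "codes_matching Q n L W t w" and Q: "orbit_rel Q" and t: "t \<in> space M"
    and x: "x \<in> Q `` {t} \<inter> L" "l < n"
  shows "y = decode t w x l \<longleftrightarrow> (\<exists>i p. (i, l, p) \<in> set w \<and> x = g i t \<and> y = g p t)" (is "_ \<longleftrightarrow> ?P y")
proof -
  obtain i where "x = g i t" using orbit_relD[OF Q _ t] x by blast
  then have ex: "\<exists>y. ?P y" using w x unfolding codes_matching_def by (metis Image_singleton_iff IntE)
  have uniq: "y = y'" if "?P y" "?P y'" for y y'
  proof -
    obtain i p i' p' where "(i, l, p) \<in> set w" "x = g i t" "y = g p t"
      "(i', l, p') \<in> set w" "x = g i' t" "y' = g p' t" using \<open>?P y\<close> \<open>?P y'\<close> by blast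
    then show ?thesis using w unfolding codes_matching_def by metis
  qed
  show ?thesis
    unfolding decode_def using someI_ex[OF ex] uniq by blast
qed

text \<open>Injectivity is the third clause of \<open>codes_matching\<close> read from left to
  right.\<close>

lemma decode_inj:
  assumes w: "codes_matching Q n L W t w" and Q: "orbit_rel Q" and t: "t \<in> space M"
  shows "inj_on (case_prod (decode t w)) ((Q `` {t} \<inter> L) \<times> {..<n})"
    and "x \<in> Q `` {t} \<inter> L \<Longrightarrow> l < n \<Longrightarrow> (x, decode t w x l) \<in> \<rho> \<and> decode t w x l \<in> W"
proof -
  note dec = decode[OF assms]
  show "inj_on (case_prod (decode t w)) ((Q `` {t} \<inter> L) \<times> {..<n})"
  proof (rule inj_onI, clarify)
    fix x l x' l'
    assume x: "(t, x) \<in> Q" "x \<in> L" "l < n" "(t, x') \<in> Q" "x' \<in> L" "l' < n"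
      and eq: "decode t w x l = decode t w x' l'"
    obtain i p where 1: "(i, l, p) \<in> set w" "x = g i t" "decode t w x l = g p t"
      using dec[of x l "decode t w x l"] x by auto
    obtain i' p' where 2: "(i', l', p') \<in> set w" "x' = g i' t" "decode t w x' l' = g p' t"
      using dec[of x' l' "decode t w x' l'"] x by auto
    have "g i t = g i' t \<and> l = l'"
      using w 1(1) 2(1) eq 1(3) 2(3) unfolding codes_matching_def by metis
    then show "x = x' \<and> l = l'" using 1 2 by simp
  qed
  assume x: "x \<in> Q `` {t} \<inter> L" "l < n"
  obtain i p where "(i, l, p) \<in> set w" "x = g i t" "decode t w x l = g p t"
    using dec[of x l "decode t w x l"] x by auto
  then show "(x, decode t w x l) \<in> \<rho> \<and> decode t w x l \<in> W"
    using w unfolding codes_matching_def by metis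
qed

section \<open>Borel matchings on the covering sets\<close>

text \<open>One round of the construction. Each class of points of \<open>D\<close> linked at scale
  \<open>K\<close> takes the matching with the least code at its representative. This choice is
  Borel, and it is constant on classes as \<open>expands_after_local_matching\<close>
  requires.\<close>

lemma borel_matching_step:
  assumes meas: "L \<in> sets M" "W \<in> sets M" "Y \<in> sets M"
    and exp: "expands \<rho> n L W" and n: "0 < n" "d \<le> n" and K: "4 * n \<le> K"
    and fin: "\<And>y. y \<in> Y \<Longrightarrow> finite ((\<rho> ^^ K \<inter> Y \<times> Y)\<^sup>* `` {y})"
  shows "\<exists>f. borel_matching d (L \<inter> Y) W f \<and>
    expands \<rho> (n - 1) (L - Y) (W - (\<Union>l<d. f l ` (L \<inter> Y)))"
proof -
  define D where "D = L \<inter> Y"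
  have D_sets [measurable]: "D \<in> sets M" using meas by (simp add: D_def)
  have DM: "D \<subseteq> space M" and LM: "L \<subseteq> space M" using sets.sets_into_space[OF D_sets] sets.sets_into_space[OF meas(1)] by auto
  define R where "R = \<rho> ^^ K \<inter> D \<times> D"
  \<comment> \<open>The intersection discards the loops that the closure adds outside
    \<open>D\<close>.\<close>
  define E where "E = R\<^sup>* \<inter> D \<times> D"
  have oR: "orbit_rel R" unfolding R_def by (intro orbit_rel_restrict orbit_rel_relpow orbit_rel_\<rho> D_sets)
  have oE: "orbit_rel E" unfolding E_def by (intro orbit_rel_restrict orbit_rel_rtrancl oR D_sets)
  have "sym R" using relpow_sym[OF sym_\<rho>, of K] unfolding R_def by (auto simp: sym_def)
  then have "sym (R\<^sup>*)" by (rule sym_rtrancl)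
  then have eqE: "equiv D E"
    unfolding E_def by (intro equivI) (auto simp: refl_on_def sym_def trans_def)
  have finE: "finite (E `` {x})" if "x \<in> D" for x
  proof -
    have "R \<subseteq> \<rho> ^^ K \<inter> Y \<times> Y" by (auto simp: R_def D_def)
    then have "E `` {x} \<subseteq> (\<rho> ^^ K \<inter> Y \<times> Y)\<^sup>* `` {x}"
      using rtrancl_mono unfolding E_def by blast
    then show ?thesis using fin[of x] that finite_subset by (auto simp: D_def)
  qed
  have "\<exists>T\<in>sets M. T \<subseteq> D \<and> (\<forall>x\<in>D. \<exists>!t. t \<in> T \<and> (x, t) \<in> E)"
    by (rule transversal_exists[OF D_sets eqE oE finE])
  then obtain T where T: "T \<in> sets M" "T \<subseteq> D" "\<And>x. x \<in> D \<Longrightarrow> \<exists>!t. t \<in> T \<and> (x, t) \<in> E"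
    by (elim bexE conjE) (rule that, auto)
  define \<tau> where "\<tau> x = (THE t. t \<in> T \<and> (x, t) \<in> E)" for x
  have \<tau>: "\<tau> x \<in> T" "(x, \<tau> x) \<in> E" if "x \<in> D" for x
    using theI'[OF T(3)[OF that]] unfolding \<tau>_def by blast+
  have \<tau>_iff: "t = \<tau> x \<longleftrightarrow> t \<in> T \<and> (x, t) \<in> E" if "x \<in> D" for x t
    using T(3)[OF that] \<tau>[OF that] by blast
  \<comment> \<open>The ball of radius \<open>2 * n\<close> around the class is the domain on which
    \<open>expands_after_local_matching\<close> wants a matching.\<close>
  define Q where "Q = E O \<rho> ^^ (2 * n)"
  have oQ: "orbit_rel Q" unfolding Q_def by (intro orbit_rel_comp oE orbit_rel_relpow orbit_rel_\<rho>)
  have Q_Image: "Q `` {t} = (\<rho> ^^ (2 * n)) `` (E `` {t})" for t by (auto simp: Q_def)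
  have finQ: "finite (Q `` {t})" if "t \<in> D" for t
  proof -
    have "Q `` {t} = (\<Union>x\<in>E `` {t}. (\<rho> ^^ (2 * n)) `` {x})" by (auto simp: Q_def)
    moreover have "E `` {t} \<subseteq> space M" using DM by (auto simp: E_def)
    ultimately show ?thesis using finE[OF that] finite_relpow_Image by auto
  qed
  \<comment> \<open>There are countably many lists, so taking the least valid one is Borel.\<close>
  define code :: "'a \<Rightarrow> (nat \<times> nat \<times> nat) list"
    where "code t = from_nat (LEAST k. codes_matching Q n L W t (from_nat k))" for t
  have code: "codes_matching Q n L W t (code t)" if t: "t \<in> D" for t
  proof -
    obtain w where "codes_matching Q n L W t w"
      using codes_matching_exists[OF oQ _ finQ[OF t] exp LM] t DM by blast
    then have "codes_matching Q n L W t (from_nat (to_nat w))" by simp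
    then show ?thesis unfolding code_def by (rule LeastI)
  qed
  have code_measurable [measurable]: "Measurable.pred M (\<lambda>t. e \<in> set (code t))" for e
  proof -
    have [measurable]: "Measurable.pred M (\<lambda>t. codes_matching Q n L W t (from_nat k))" for k
      using meas by (intro codes_matching_measurable oQ)
    have "(\<lambda>t. LEAST k. codes_matching Q n L W t (from_nat k)) \<in> measurable M (count_space UNIV)"
      by (intro measurable_Least) measurable
    then have [measurable]: "code \<in> measurable M (count_space UNIV)" unfolding code_def by measurable
    show ?thesis by measurable
  qed
  define h where "h x = decode (\<tau> x) (code (\<tau> x))" for x
  have \<tau>D: "\<tau> x \<in> D" if "x \<in> D" for x using \<tau>(1)[OF that] T(2) by blast
  have h_cong: "h x = h y" if "(x, y) \<in> E" for x y
  proof -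
    have "E `` {x} = E `` {y}" using eqE that by (rule equiv_class_eq)
    then have "(x, t) \<in> E \<longleftrightarrow> (y, t) \<in> E" for t by blast
    then show ?thesis by (simp add: h_def \<tau>_def)
  qed
  have Q_\<tau>: "Q `` {x} = Q `` {\<tau> x}" if "x \<in> D" for x
    unfolding Q_Image using equiv_class_eq[OF eqE \<tau>(2)[OF that]] by simp
  have h: "inj_on (case_prod (h t)) (((\<rho> ^^ (2 * n)) `` (E `` {t}) \<inter> L) \<times> {..<n})"
    "x \<in> (\<rho> ^^ (2 * n)) `` (E `` {t}) \<inter> L \<Longrightarrow> l < n \<Longrightarrow> (x, h t x l) \<in> \<rho> \<and> h t x l \<in> W"
    if t: "t \<in> D" for t x l
    using decode_inj[OF code[OF \<tau>D[OF t]] oQ] \<tau>D[OF t] DM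
    unfolding h_def Q_Image[symmetric] Q_\<tau>[OF t] by blast+
  \<comment> \<open>Nearness within \<open>4 * n\<close> is a single step of \<open>R\<close>,
    because \<open>4 * n \<le> K\<close>.\<close>
  have sep: "(x, y) \<in> E" if "x \<in> D" "y \<in> D" "(x, y) \<in> \<rho> ^^ (4 * n)" for x y
    using that relpow_refl_mono[OF refl_\<rho> K] by (auto simp: E_def R_def)
  have DL: "D \<subseteq> L" by (simp add: D_def)
  have lf: "finite (\<rho> `` {x})" if "x \<in> L" for x using that LM finite_\<rho>_Image by blast
  note core = expands_after_local_matching[OF sym_\<rho> refl_\<rho> lf exp n DL eqE sep h_cong h]
  define f where "f l x = h x x l" for l x
  have self: "x \<in> Q `` {x} \<inter> L" if "x \<in> D" for x
    using that DL relpow_refl_mono[OF refl_\<rho>, of 0 "2 * n"] equiv_class_self[OF eqE that]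
    by (auto simp: Q_def)
  have "orbit_map D (f l)" if l: "l < d" for l
    unfolding orbit_map_def
  proof
    fix j
    have [measurable]: "Measurable.pred M (\<lambda>x. (x, g m x) \<in> E)" for m
      by (rule orbit_rel_measurable_id[OF oE])
    \<comment> \<open>Among the \<open>g m x\<close>, the representative \<open>\<tau> x\<close> is
      the only member of \<open>T\<close> related to \<open>x\<close>; quantifying over
      \<open>m\<close> keeps the condition Borel.\<close>
    have "f l x = g j x \<longleftrightarrow> (\<exists>m i p. g m x \<in> T \<and> (x, g m x) \<in> E \<and> (i, l, p) \<in> set (code (g m x)) \<and>
        x = g i (g m x) \<and> g j x = g p (g m x))" if x: "x \<in> D" for x
    proof -
      have xM: "x \<in> space M" "\<tau> x \<in> space M" using x \<tau>D[OF x] DM by auto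
      have "g j x = f l x \<longleftrightarrow>
          (\<exists>i p. (i, l, p) \<in> set (code (\<tau> x)) \<and> x = g i (\<tau> x) \<and> g j x = g p (\<tau> x))"
        unfolding f_def h_def
        using l n(2) self[OF x] Q_\<tau>[OF x] by (intro decode[OF code[OF \<tau>D[OF x]] oQ xM(2)]) auto
      moreover obtain m where m: "\<tau> x = g m x" using orbit_relD[OF oE \<tau>(2)[OF x] xM(1)] by blast
      ultimately show ?thesis using \<tau>[OF x] \<tau>_iff[OF x] by metis
    qed
    then have "{x \<in> D. f l x = g j x} = {x \<in> space M. x \<in> D \<and> (\<exists>m i p. g m x \<in> T \<and> (x, g m x) \<in> E \<and>
        (i, l, p) \<in> set (code (g m x)) \<and> x = g i (g m x) \<and> g j x = g p (g m x))}"
      using DM by blast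
    also have "\<dots> \<in> sets M" using T(1) by measurable
    finally show "{x \<in> D. f l x = g j x} \<in> sets M" .
  qed
  moreover have "(x, f l x) \<in> \<rho> \<and> f l x \<in> W" if "x \<in> D" "l < d" for x l
    unfolding f_def using that n(2) self[OF that(1)] Q_Image by (intro h(2)) auto
  ultimately have "borel_matching d D W f"
    using core(1) by (simp add: borel_matching_def f_def)
  moreover have "L - D = L - Y" by (auto simp: D_def)
  ultimately show ?thesis using core(2) unfolding D_def[symmetric] by (auto simp: f_def)
qed

text \<open>Every round costs one unit of expansion, so all \<open>N\<close> rounds start with more
  than \<open>d\<close> units. The scale \<open>K\<close> of the first round serves the later ones,
  whose radii are smaller.\<close>

lemma borel_matching_exists:
  assumes "L \<in> sets M" "W \<in> sets M" and "expands \<rho> (N + d) L W" and "4 * (N + d) \<le> K"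
    and "\<And>i. i < N \<Longrightarrow> Y i \<in> sets M"
    and "\<And>i y. i < N \<Longrightarrow> y \<in> Y i \<Longrightarrow> finite ((\<rho> ^^ K \<inter> Y i \<times> Y i)\<^sup>* `` {y})"
  shows "\<exists>f. borel_matching d (L \<inter> (\<Union>i<N. Y i)) W f"
  using assms
proof (induction N arbitrary: L W)
  case 0
  then show ?case by (auto simp: borel_matching_def orbit_map_def)
next
  case (Suc N)
  let ?U = "\<Union>i<N. Y i"
  have YN: "Y N \<in> sets M" and U: "?U \<in> sets M" using Suc.prems(5) by auto
  obtain f where f: "borel_matching d (L \<inter> Y N) W f"
    "expands \<rho> (N + d) (L - Y N) (W - (\<Union>l<d. f l ` (L \<inter> Y N)))"
    using borel_matching_step[of L W "Y N" "Suc N + d" d K] Suc.prems by auto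
  have LY: "L \<inter> Y N \<subseteq> space M" using Suc.prems(1) sets.sets_into_space by blast
  \<comment> \<open>The used values form a Borel set, so the induction hypothesis applies to what is
    left of \<open>W\<close>.\<close>
  have "(\<Union>l<d. f l ` (L \<inter> Y N)) \<in> sets M"
    using f(1) by (intro sets.finite_UN orbit_map_image[OF _ _ LY]) (auto simp: borel_matching_def)
  then have "\<exists>f'. borel_matching d ((L - Y N) \<inter> ?U) (W - (\<Union>l<d. f l ` (L \<inter> Y N))) f'"
    using Suc.prems f(2) YN by (intro Suc.IH) auto
  then obtain f' where f': "borel_matching d ((L - Y N) \<inter> ?U) (W - (\<Union>l<d. f l ` (L \<inter> Y N))) f'" ..
  let ?h = "\<lambda>l x. if x \<in> Y N then f l x else f' l x"
  have D: "L \<inter> (\<Union>i<Suc N. Y i) = (L \<inter> Y N) \<union> ((L - Y N) \<inter> ?U)" by (auto simp: less_Suc_eq)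
  have "borel_matching d (L \<inter> (\<Union>i<Suc N. Y i)) W ?h"
    unfolding D borel_matching_def
  proof (intro conjI allI impI ballI)
    fix l assume "l < d"
    then show "orbit_map ((L \<inter> Y N) \<union> ((L - Y N) \<inter> ?U)) (?h l)"
      using f(1) f' by (intro orbit_map_If) (auto simp: borel_matching_def)
  next
    show "inj_on (\<lambda>(x, l). ?h l x) (((L \<inter> Y N) \<union> ((L - Y N) \<inter> ?U)) \<times> {..<d})"
    proof (rule inj_onI, clarify)
      fix x l x' l'
      assume *: "x \<in> (L \<inter> Y N) \<union> ((L - Y N) \<inter> ?U)" "x' \<in> (L \<inter> Y N) \<union> ((L - Y N) \<inter> ?U)"
        "l < d" "l' < d" "?h l x = ?h l' x'"
      have inj: "inj_on (\<lambda>(x, l). f l x) ((L \<inter> Y N) \<times> {..<d})"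
        "inj_on (\<lambda>(x, l). f' l x) (((L - Y N) \<inter> ?U) \<times> {..<d})"
        using f(1) f' by (auto simp: borel_matching_def)
      \<comment> \<open>Later values come from the reduced target, so they cannot collide with those
        used on \<open>Y N\<close>.\<close>
      have ran: "f' l x \<notin> (\<Union>l<d. f l ` (L \<inter> Y N))" if "x \<in> (L - Y N) \<inter> ?U" "l < d" for x l
        using f' that unfolding borel_matching_def by blast
      show "x = x' \<and> l = l'"
      proof (cases "x \<in> Y N"; cases "x' \<in> Y N")
        assume c: "x \<in> Y N" "x' \<in> Y N"
        then show ?thesis using inj_onD[OF inj(1), of "(x, l)" "(x', l')"] * by auto
      next
        assume c: "x \<notin> Y N" "x' \<notin> Y N"
        then show ?thesis using inj_onD[OF inj(2), of "(x, l)" "(x', l')"] * by auto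
      next
        assume c: "x \<in> Y N" "x' \<notin> Y N"
        then have "f' l' x' = f l x" "x \<in> L \<inter> Y N" "x' \<in> (L - Y N) \<inter> ?U" using * by auto
        then show ?thesis using ran[of x' l'] *(3,4) by blast
      next
        assume c: "x \<notin> Y N" "x' \<in> Y N"
        then have "f' l x = f l' x'" "x' \<in> L \<inter> Y N" "x \<in> (L - Y N) \<inter> ?U" using * by auto
        then show ?thesis using ran[of x l] *(3,4) by blast
      qed
    qed
  qed (use f(1) f' in \<open>auto simp: borel_matching_def\<close>)
  then show ?case by blast
qed

section \<open>From injections to paradoxical decompositions\<close>

text \<open>Cut \<open>A\<close> by the first index in \<open>I\<close> whose move agrees with
  \<open>h\<close>. The pieces are finitely many because \<open>I\<close> is finite; an index
  outside \<open>I\<close> gives an empty piece.\<close>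

lemma borel_equidecomposable_image:
  assumes act: "\<And>i. \<exists>\<gamma>\<in>carrier G. g i = \<phi> \<gamma>"
    and A: "A \<in> sets M" and h: "orbit_map A h" "inj_on h A" "\<And>x. x \<in> A \<Longrightarrow> (x, h x) \<in> \<rho>"
  shows "borel_equidecomposable G M \<phi> A (h ` A)"
proof -
  obtain k where k: "I \<subseteq> {..<k}" using finite_nat_bounded[OF finite_I] ..
  define P where "P i = {x \<in> A. i \<in> I \<and> h x = g i x \<and> (\<forall>j<i. j \<in> I \<longrightarrow> h x \<noteq> g j x)}" for i
  have P_g: "g i ` P i = h ` P i" for i by (auto simp: P_def image_iff)
  have P_sets: "P i \<in> sets M" for i
  proof -
    have eq: "{x \<in> A. h x = g j x} \<in> sets M" for j using h(1) by (simp add: orbit_map_def)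
    have "P i = (if i \<in> I then {x \<in> A. h x = g i x} - (\<Union>j\<in>{..<i} \<inter> I. {x \<in> A. h x = g j x}) else {})"
      by (auto simp: P_def)
    then show ?thesis using eq by auto
  qed
  have dis: "P i \<inter> P j = {}" if "i \<noteq> j" for i j
    using that by (cases i j rule: linorder_cases) (auto simp: P_def)
  have "A \<subseteq> (\<Union>i<k. P i)"
  proof
    fix x assume x: "x \<in> A"
    then have "\<exists>i. i \<in> I \<and> h x = g i x"
      using h(3)[OF x] \<rho>_iff sets.sets_into_space[OF A] by blast
    then obtain i where "i \<in> I \<and> h x = g i x" "\<And>j. j < i \<Longrightarrow> \<not> (j \<in> I \<and> h x = g j x)"
      using exists_least_iff[of "\<lambda>i. i \<in> I \<and> h x = g i x"] by blast
    then show "x \<in> (\<Union>i<k. P i)" using x k by (auto simp: P_def)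
  qed
  then have A_eq: "(\<Union>i<k. P i) = A" by (auto simp: P_def)
  have PA: "P i \<subseteq> A" for i by (auto simp: P_def)
  have "equidecomposition G \<phi> A (h ` A) k P (\<lambda>i. h ` P i)"
    unfolding equidecomposition_def
  proof (intro conjI allI impI)
    show "disjoint_family_on P {..<k}" using dis by (auto simp: disjoint_family_on_def)
    show "disjoint_family_on (\<lambda>i. h ` P i) {..<k}"
      unfolding disjoint_family_on_def using dis PA inj_on_image_Int[OF h(2)] by (metis image_empty)
    show "(\<Union>i<k. h ` P i) = h ` A" using A_eq by blast
    show "\<exists>\<gamma>\<in>carrier G. h ` P i = \<phi> \<gamma> ` P i" for i using act[of i] P_g[of i] by metis
  qed (rule A_eq)
  moreover have "h ` P i \<in> sets M" for i using image_g_sets[OF P_sets] by (metis P_g)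
  ultimately show ?thesis unfolding borel_equidecomposable_def using P_sets by blast
qed

text \<open>Banach's argument: \<open>f 0\<close> carries \<open>A\<close> onto \<open>A0\<close>,
  while \<open>f 1\<close> carries \<open>A\<close> into \<open>A - A0\<close>. Using
  \<open>f 1\<close> on the forward orbit \<open>S\<close> of \<open>A0\<close> and the identity
  elsewhere maps \<open>A\<close> onto \<open>A - A0\<close> injectively.\<close>

lemma borel_paradoxical_if_matching:
  assumes act: "\<And>i. \<exists>\<gamma>\<in>carrier G. g i = \<phi> \<gamma>"
    and A: "A \<in> sets M" and f: "borel_matching 2 A A f"
  shows "borel_paradoxical G M \<phi> A"
proof -
  have AM: "A \<subseteq> space M" using sets.sets_into_space[OF A] .
  have orb: "orbit_map A (f 0)" "orbit_map A (f 1)"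
    and \<rho>: "\<And>x. x \<in> A \<Longrightarrow> (x, f 0 x) \<in> \<rho>" "\<And>x. x \<in> A \<Longrightarrow> (x, f 1 x) \<in> \<rho>"
    and into: "\<And>x. x \<in> A \<Longrightarrow> f 0 x \<in> A" "\<And>x. x \<in> A \<Longrightarrow> f 1 x \<in> A"
    and inj: "inj_on (\<lambda>(x, l). f l x) (A \<times> {..<2})"
    using f by (auto simp: borel_matching_def)
  have inj0: "inj_on (f 0) A"
    by (rule inj_onI) (use inj_onD[OF inj, of "(_, 0)" "(_, 0)"] in auto)
  have inj1: "x = y" if "x \<in> A" "y \<in> A" "f 1 x = f 1 y" for x y
    using inj_onD[OF inj, of "(x, 1)" "(y, 1)"] that by auto
  have neq: "f 1 x \<noteq> f 0 y" if "x \<in> A" "y \<in> A" for x y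
    using inj_onD[OF inj, of "(x, 1)" "(y, 0)"] that by auto
  define A0 where "A0 = f 0 ` A"
  \<comment> \<open>Closed under \<open>f 1\<close>, with image \<open>S - A0\<close>: exactly the
    part \<open>A0\<close> is vacated.\<close>
  define S where "S = (\<Union>n. (f 1 ^^ n) ` A0)"
  define h where "h x = (if x \<in> S then f 1 x else x)" for x
  have S_n: "(f 1 ^^ n) ` A0 \<in> sets M \<and> (f 1 ^^ n) ` A0 \<subseteq> A" for n
  proof (induction n)
    case 0
    then show ?case using orbit_map_image[OF orb(1) \<rho>(1) AM] into by (auto simp: A0_def)
  next
    case (Suc n)
    have "f 1 ` (f 1 ^^ n) ` A0 \<in> sets M"
    proof (rule orbit_map_image)
      show "orbit_map ((f 1 ^^ n) ` A0) (f 1)" using orbit_map_subset[OF orb(2)] Suc by blast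
    qed (use Suc \<rho>(2) AM in blast)+
    moreover have "(f 1 ^^ Suc n) ` A0 = f 1 ` (f 1 ^^ n) ` A0" by (simp add: image_comp)
    moreover have "f 1 ` (f 1 ^^ n) ` A0 \<subseteq> A"
      by (intro image_subsetI into(2)) (use Suc in auto)
    ultimately show ?case by (simp only: simp_thms)
  qed
  have S: "S \<in> sets M" "S \<subseteq> A" using S_n by (auto simp: S_def)
  have A0S: "A0 \<subseteq> S" using UN_upper[of 0 UNIV "\<lambda>n. (f 1 ^^ n) ` A0"] by (simp add: S_def)
  have fS: "f 1 x \<in> S" if x: "x \<in> S" for x
  proof -
    obtain n a where "a \<in> A0" "x = (f 1 ^^ n) a" using x by (auto simp: S_def)
    then have "f 1 x \<in> (f 1 ^^ Suc n) ` A0" by auto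
    then show ?thesis unfolding S_def by blast
  qed
  have "h ` A = A - A0"
  proof
    show "h ` A \<subseteq> A - A0" using into(2) neq A0S by (auto simp: h_def A0_def)
    show "A - A0 \<subseteq> h ` A"
    proof
      fix y assume y: "y \<in> A - A0"
      show "y \<in> h ` A"
      proof (cases "y \<in> S")
        case True
        then obtain n a where na: "a \<in> A0" "y = (f 1 ^^ n) a" by (auto simp: S_def)
        then obtain m where "n = Suc m" using y by (cases n) auto
        then have m: "y = f 1 ((f 1 ^^ m) a)" "(f 1 ^^ m) a \<in> S" using na by (auto simp: S_def)
        then have "y = h ((f 1 ^^ m) a)" by (simp add: h_def)
        then show ?thesis using m(2) S(2) by blast
      next
        case False
        then have "y = h y" by (simp add: h_def)
        then show ?thesis using y by blast
      qed
    qed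
  qed
  moreover have "inj_on h A"
    by (rule inj_onI) (use inj1 fS in \<open>auto simp: h_def split: if_splits\<close>)
  moreover have "orbit_map A h"
  proof -
    have "A - S \<in> sets M" using A S by auto
    then have "orbit_map (A - S) (\<lambda>x. x)"
      unfolding orbit_map_def
    proof (intro allI)
      fix j
      assume [measurable]: "A - S \<in> sets M"
      have "{x \<in> A - S. x = g j x} = {x \<in> space M. x \<in> A - S \<and> x = g j x}" using AM by auto
      also have "\<dots> \<in> sets M" by measurable
      finally show "{x \<in> A - S. x = g j x} \<in> sets M" .
    qed
    then have "orbit_map (S \<union> (A - S)) h"
      unfolding h_def by (rule orbit_map_If[OF orbit_map_subset[OF orb(2) S]]) auto
    then show ?thesis using S(2) by (simp add: Un_absorb1)
  qed
  moreover have "(x, h x) \<in> \<rho>" if "x \<in> A" for x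
    using that \<rho>(2) refl_\<rho> by (auto simp: h_def refl_on_def)
  ultimately have "borel_equidecomposable G M \<phi> A (A - A0)"
    using borel_equidecomposable_image[OF act A, of h] by simp
  moreover have "borel_equidecomposable G M \<phi> A A0"
    unfolding A0_def by (rule borel_equidecomposable_image[OF act A orb(1) inj0 \<rho>(1)])
  moreover have "A0 \<subseteq> A" using into by (auto simp: A0_def)
  ultimately show ?thesis unfolding borel_paradoxical_def by (intro exI[of _ A0] exI[of _ "A - A0"]) auto
qed

end

section \<open>Group actions\<close>

text \<open>A countable base will do: finite sets are closed, so \<open>x\<close> has a basic
  neighbourhood that misses the rest of \<open>F\<close>.\<close>

lemma standard_borel_separating:
  fixes M :: "'a measure"
  assumes "standard_borel M"
  shows "\<exists>V :: nat \<Rightarrow> 'a set. (\<forall>m. V m \<in> sets M) \<and>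
    (\<forall>F x. finite F \<longrightarrow> F \<subseteq> space M \<longrightarrow> x \<in> F \<longrightarrow> (\<exists>m. V m \<inter> F = {x}))"
proof -
  obtain T where T: "completely_metrizable_space T" "second_countable T" "topspace T = space M"
    "sets M = sigma_sets (space M) {U. openin T U}"
    using assms unfolding standard_borel_def by blast
  obtain \<B> where \<B>: "countable \<B>" "\<And>B. B \<in> \<B> \<Longrightarrow> openin T B"
    "\<And>U x. openin T U \<Longrightarrow> x \<in> U \<Longrightarrow> \<exists>B\<in>\<B>. x \<in> B \<and> B \<subseteq> U"
    using T(2) unfolding second_countable_def by metis
  \<comment> \<open>Adding the empty set makes the family nonempty, so that it is the range of a
    sequence.\<close>
  define V where "V = from_nat_into (insert {} \<B>)"
  have range: "range V = insert {} \<B>" unfolding V_def using \<B>(1) by (intro range_from_nat_into) auto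
  have "V m \<in> sets M" for m
  proof -
    have "openin T (V m)" using range \<B>(2) openin_empty by (metis insertE rangeI)
    then show ?thesis unfolding T(4) by (intro sigma_sets.Basic) simp
  qed
  moreover have "\<exists>m. V m \<inter> F = {x}" if F: "finite F" "F \<subseteq> space M" "x \<in> F" for F x
  proof -
    have "t1_space T"
      using T(1) by (intro Hausdorff_imp_t1_space metrizable_imp_Hausdorff_space
          completely_metrizable_imp_metrizable_space)
    then have "closedin T (F - {x})" using F T(3) by (auto simp: t1_space_closedin_finite)
    then have "openin T (topspace T - (F - {x}))" by blast
    then obtain B where "B \<in> \<B>" "x \<in> B" "B \<subseteq> topspace T - (F - {x})" using \<B>(3) F T(3) by blast
    then have "B \<inter> F = {x}" "B \<in> range V" using F range by auto
    then show ?thesis by blast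
  qed
  ultimately show ?thesis by (intro exI[of _ V]) simp
qed

text \<open>The elements are products of words in generators and inverses, and the words are
  countably many.\<close>

lemma (in group) countable_generate:
  assumes "countable S" "S \<subseteq> carrier G"
  shows "countable (generate G S)"
proof -
  let ?S = "S \<union> m_inv G ` S"
  let ?p = "\<lambda>ws. foldr (\<otimes>) ws \<one>"
  have in_carrier: "set ws \<subseteq> carrier G \<Longrightarrow> ?p ws \<in> carrier G" for ws by (induction ws) auto
  have append: "set us \<subseteq> carrier G \<Longrightarrow> set ws \<subseteq> carrier G \<Longrightarrow> ?p (us @ ws) = ?p us \<otimes> ?p ws" for us ws
    by (induction us) (auto simp: in_carrier m_assoc)
  have sub: "set ws \<subseteq> carrier G" if "ws \<in> lists ?S" for ws using that assms(2) by auto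
  have "x \<in> ?p ` lists ?S" if "x \<in> generate G S" for x
    using that
  proof induction
    case one
    show ?case by (rule image_eqI[of _ _ "[]"]) auto
  next
    case (incl h)
    then show ?case using assms(2) by (intro image_eqI[of _ _ "[h]"]) auto
  next
    case (inv h)
    then show ?case using assms(2) by (intro image_eqI[of _ _ "[inv h]"]) auto
  next
    case (eng a b)
    then obtain us ws where "us \<in> lists ?S" "ws \<in> lists ?S" "a = ?p us" "b = ?p ws" by blast
    then show ?case using sub append by (intro image_eqI[of _ _ "us @ ws"]) auto
  qed
  then have "generate G S \<subseteq> ?p ` lists ?S" by blast
  then show ?thesis using assms(1) by (meson countable_Un countable_image countable_lists countable_subset)
qed

section \<open>Doubling and expansion\<close>

text \<open>Trades the pieces for one bijection that displaces points by finitely many group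
  elements, the form in which it can be iterated.\<close>

lemma equidecomposable_map:
  assumes act: "group_action G X \<phi>" and A: "A \<subseteq> X" and eq: "equidecomposable G \<phi> A B"
  shows "\<exists>f R. bij_betw f A B \<and> finite R \<and> R \<subseteq> carrier G \<and> (\<forall>x\<in>A. \<exists>\<gamma>\<in>R. f x = \<phi> \<gamma> x)"
proof -
  interpret group_action G X \<phi> by (rule act)
  obtain k P Q where "equidecomposition G \<phi> A B k P Q"
    using eq unfolding equidecomposable_def by blast
  then have P: "(\<Union>i<k. P i) = A" and Pd: "disjoint_family_on P {..<k}"
    and Q: "(\<Union>i<k. Q i) = B" and Qd: "disjoint_family_on Q {..<k}"
    and PQ: "\<forall>i<k. \<exists>\<gamma>\<in>carrier G. Q i = \<phi> \<gamma> ` P i"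
    unfolding equidecomposition_def by simp_all
  obtain \<gamma> where \<gamma>: "\<And>i. i < k \<Longrightarrow> \<gamma> i \<in> carrier G" "\<And>i. i < k \<Longrightarrow> Q i = \<phi> (\<gamma> i) ` P i" using PQ by metis
  have "\<forall>x\<in>A. \<exists>i<k. x \<in> P i" using P by blast
  then obtain \<iota> where \<iota>: "\<And>x. x \<in> A \<Longrightarrow> \<iota> x < k" "\<And>x. x \<in> A \<Longrightarrow> x \<in> P (\<iota> x)" by metis
  define f where "f x = \<phi> (\<gamma> (\<iota> x)) x" for x
  have fQ: "f x \<in> Q (\<iota> x)" if "x \<in> A" for x using \<gamma>(2) \<iota> that by (auto simp: f_def)
  have "inj_on f A"
  proof (rule inj_onI)
    fix x y assume xy: "x \<in> A" "y \<in> A" "f x = f y"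
    then have i: "\<iota> x = \<iota> y" using Qd fQ[of x] fQ[of y] \<iota>(1) by (auto simp: disjoint_family_on_def)
    have "inj_on (\<phi> (\<gamma> (\<iota> x))) X" using \<gamma>(1) \<iota>(1)[OF xy(1)] by (intro inj_prop)
    then show "x = y" using xy i A by (auto simp: f_def dest: inj_onD)
  qed
  moreover have "f ` A = B"
  proof
    show "f ` A \<subseteq> B" using fQ \<iota>(1) Q by blast
    show "B \<subseteq> f ` A"
    proof
      fix y assume "y \<in> B"
      then obtain i x where i: "i < k" "x \<in> P i" "y = \<phi> (\<gamma> i) x" using Q \<gamma>(2) by blast
      then have "x \<in> A" using P by blast
      moreover have "\<iota> x = i" using \<iota>[OF \<open>x \<in> A\<close>] i Pd by (auto simp: disjoint_family_on_def)
      ultimately show "y \<in> f ` A" using i(3) by (auto simp: f_def)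
    qed
  qed
  ultimately have "bij_betw f A B" by (simp add: bij_betw_def)
  moreover have "\<forall>x\<in>A. \<exists>\<gamma>'\<in>\<gamma> ` {..<k}. f x = \<phi> \<gamma>' x" using \<iota>(1) by (auto simp: f_def)
  moreover have "\<gamma> ` {..<k} \<subseteq> carrier G" using \<gamma>(1) by auto
  ultimately show ?thesis by (intro exI[of _ f] exI[of _ "\<gamma> ` {..<k}"]) auto
qed

text \<open>One step replaces \<open>F\<close> by its two disjoint images in \<open>A\<close>,
  doubling its size.\<close>

lemma expands_if_doubling:
  assumes f0: "inj_on f0 A" "f0 ` A \<subseteq> A" and f1: "inj_on f1 A" "f1 ` A \<subseteq> A"
    and dis: "f0 ` A \<inter> f1 ` A = {}"
    and \<sigma>: "\<And>x. x \<in> A \<Longrightarrow> (x, f0 x) \<in> \<sigma> \<and> (x, f1 x) \<in> \<sigma>"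
    and fin: "\<And>x p. x \<in> A \<Longrightarrow> finite ((\<sigma> ^^ p) `` {x})"
  shows "expands (\<sigma> ^^ p) (2 ^ p) A A"
proof (induction p)
  case 0
  then show ?case by (auto simp: expands_def Int_absorb2)
next
  case (Suc p)
  show ?case
    unfolding expands_def
  proof (intro allI impI)
    fix F assume F: "finite F" "F \<subseteq> A"
    let ?T = "f0 ` F \<union> f1 ` F"
    have "card ?T = card (f0 ` F) + card (f1 ` F)"
      using F dis by (intro card_Un_disjoint) auto
    also have "\<dots> = 2 * card F"
      using F(2) f0(1) f1(1) by (simp add: card_image inj_on_subset)
    finally have "2 ^ Suc p * card F = 2 ^ p * card ?T" by simp
    also have "\<dots> \<le> card ((\<sigma> ^^ p) `` ?T \<inter> A)"
    proof -
      have "finite ?T" "?T \<subseteq> A" using F f0(2) f1(2) by auto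
      then show ?thesis by (rule Suc[unfolded expands_def, rule_format])
    qed
    also have "\<dots> \<le> card ((\<sigma> ^^ Suc p) `` F \<inter> A)"
    proof (intro card_mono finite_Int disjI1)
      show "finite ((\<sigma> ^^ Suc p) `` F)"
        unfolding Image_eq_UN[of _ F] using F fin by (intro finite_UN_I) blast+
      have "?T \<subseteq> \<sigma> `` F" using F(2) \<sigma> by blast
      \<comment> \<open>The doubling step comes first, while \<open>relpow\<close> splits off the
        last step; powers commute.\<close>
      then have "(\<sigma> ^^ p) `` ?T \<subseteq> (\<sigma> O \<sigma> ^^ p) `` F" by blast
      then show "(\<sigma> ^^ p) `` ?T \<inter> A \<subseteq> (\<sigma> ^^ Suc p) `` F \<inter> A"
        unfolding relpow.simps relpow_commute[symmetric] by (rule Int_mono) simp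
    qed
    finally show "2 ^ Suc p * card F \<le> card ((\<sigma> ^^ Suc p) `` F \<inter> A)" .
  qed
qed

section \<open>Schreier graphs and the separation index\<close>

text \<open>Inverses enter because edges are unordered, the identity because of the reflexive
  closure.\<close>

lemma schreier_step_iff:
  assumes act: "group_action G X \<phi>" and S: "S \<subseteq> carrier G" and x: "x \<in> X"
  shows "(x, y) \<in> (adj (schreier X \<phi> S))\<^sup>= \<longleftrightarrow>
    (\<exists>\<gamma>\<in>insert \<one>\<^bsub>G\<^esub> (S \<union> m_inv G ` S). y = \<phi> \<gamma> x)"
proof -
  interpret group_action G X \<phi> by (rule act)
  interpret group G using group_hom group_hom.axioms(1) by blast
  have one: "\<phi> \<one>\<^bsub>G\<^esub> x = x" using id_eq_one x by (metis restrict_apply')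
  have inv1: "\<phi> (inv\<^bsub>G\<^esub> \<gamma>) (\<phi> \<gamma> z) = z" if "\<gamma> \<in> carrier G" "z \<in> X" for \<gamma> z
    using orbit_sym_aux that by blast
  have inv2: "\<phi> \<gamma> (\<phi> (inv\<^bsub>G\<^esub> \<gamma>) z) = z" if "\<gamma> \<in> carrier G" "z \<in> X" for \<gamma> z
    using inv1[of "inv\<^bsub>G\<^esub> \<gamma>" z] that by simp
  have space: "\<phi> \<gamma> z \<in> X" if "\<gamma> \<in> carrier G" "z \<in> X" for \<gamma> z using element_image that by blast
  have edge: "{z, \<phi> \<sigma> z} \<in> schreier X \<phi> S" if "z \<in> X" "\<sigma> \<in> S" "z \<noteq> \<phi> \<sigma> z" for \<sigma> z
    unfolding schreier_def using that by (intro CollectI exI[of _ z] exI[of _ \<sigma>]) simp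
  show ?thesis
  proof
    assume "(x, y) \<in> (adj (schreier X \<phi> S))\<^sup>="
    then consider "x = y" | \<sigma> where "\<sigma> \<in> S" "y = \<phi> \<sigma> x" | \<sigma> where "\<sigma> \<in> S" "y \<in> X" "x = \<phi> \<sigma> y"
      by (auto simp: adj_def schreier_def doubleton_eq_iff)
    then show "\<exists>\<gamma>\<in>insert \<one>\<^bsub>G\<^esub> (S \<union> m_inv G ` S). y = \<phi> \<gamma> x"
    proof cases
      case (3 \<sigma>)
      then have "y = \<phi> (inv\<^bsub>G\<^esub> \<sigma>) x" using inv1 S by (metis subsetD)
      then show ?thesis using 3(1) by blast
    qed (use one in auto)
  next
    assume "\<exists>\<gamma>\<in>insert \<one>\<^bsub>G\<^esub> (S \<union> m_inv G ` S). y = \<phi> \<gamma> x"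
    then consider "y = x" | \<sigma> where "\<sigma> \<in> S" "y = \<phi> \<sigma> x" | \<sigma> where "\<sigma> \<in> S" "y = \<phi> (inv\<^bsub>G\<^esub> \<sigma>) x"
      using one by auto
    then have "y = x \<or> {x, y} \<in> schreier X \<phi> S"
    proof cases
      case (2 \<sigma>)
      then show ?thesis using edge[OF x 2(1)] by (cases "y = x") auto
    next
      case (3 \<sigma>)
      have "\<sigma> \<in> carrier G" using 3(1) S by blast
      then have y: "y \<in> X" "x = \<phi> \<sigma> y" using 3 x space inv2 by auto
      show ?thesis
      proof (cases "y = x")
        case False
        then show ?thesis using edge[OF y(1) 3(1)] y(2) by (simp add: insert_commute)
      qed simp
    qed simp
    then show "(x, y) \<in> (adj (schreier X \<phi> S))\<^sup>=" by (auto simp: adj_def)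
  qed
qed

text \<open>Products of \<open>n\<close> generators, inverses or identities describe the ball
  uniformly in \<open>x\<close>; the resulting finite \<open>J\<close> later yields the index set
  \<open>I\<close>.\<close>

lemma schreier_ball_iff:
  assumes act: "group_action G X \<phi>" and S: "finite S" "S \<subseteq> carrier G"
  shows "\<exists>J. finite J \<and> J \<subseteq> carrier G \<and>
    (\<forall>x\<in>X. \<forall>y. (x, y) \<in> ((adj (schreier X \<phi> S))\<^sup>=) ^^ n \<longleftrightarrow> (\<exists>\<gamma>\<in>J. y = \<phi> \<gamma> x))"
proof -
  interpret group_action G X \<phi> by (rule act)
  interpret group G using group_hom group_hom.axioms(1) by blast
  let ?J = "insert \<one>\<^bsub>G\<^esub> (S \<union> m_inv G ` S)"
  let ?R = "(adj (schreier X \<phi> S))\<^sup>="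
  have J: "finite ?J" "?J \<subseteq> carrier G" using S by auto
  show ?thesis
  proof (induction n)
    case 0
    have "\<phi> \<one>\<^bsub>G\<^esub> x = x" if "x \<in> X" for x using id_eq_one that by (metis restrict_apply')
    then show ?case by (intro exI[of _ "{\<one>\<^bsub>G\<^esub>}"]) auto
  next
    case (Suc n)
    then obtain J where IH: "finite J" "J \<subseteq> carrier G"
      "\<And>x y. x \<in> X \<Longrightarrow> (x, y) \<in> ?R ^^ n \<longleftrightarrow> (\<exists>\<gamma>\<in>J. y = \<phi> \<gamma> x)" by blast
    have "(x, y) \<in> ?R ^^ Suc n \<longleftrightarrow> (\<exists>\<gamma>\<in>(\<Union>b\<in>J. (\<lambda>a. a \<otimes>\<^bsub>G\<^esub> b) ` ?J). y = \<phi> \<gamma> x)" if x: "x \<in> X" for x y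
    proof -
      have "(x, y) \<in> ?R ^^ Suc n \<longleftrightarrow> (\<exists>z. (x, z) \<in> ?R ^^ n \<and> (z, y) \<in> ?R)" by auto
      also have "\<dots> \<longleftrightarrow> (\<exists>b\<in>J. (\<phi> b x, y) \<in> ?R)" unfolding IH(3)[OF x] by auto
      also have "\<dots> \<longleftrightarrow> (\<exists>b\<in>J. \<exists>a\<in>?J. y = \<phi> a (\<phi> b x))"
      proof (rule bex_cong[OF refl])
        fix b assume "b \<in> J"
        then have "\<phi> b x \<in> X" using element_image IH(2) x by blast
        then show "(\<phi> b x, y) \<in> ?R \<longleftrightarrow> (\<exists>a\<in>?J. y = \<phi> a (\<phi> b x))"
          by (rule schreier_step_iff[OF act S(2)])
      qed
      also have "\<dots> \<longleftrightarrow> (\<exists>b\<in>J. \<exists>a\<in>?J. y = \<phi> (a \<otimes>\<^bsub>G\<^esub> b) x)"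
        by (intro bex_cong refl) (simp only: composition_rule[OF x subsetD[OF J(2)] subsetD[OF IH(2)]])
      also have "\<dots> \<longleftrightarrow> (\<exists>\<gamma>\<in>(\<Union>b\<in>J. (\<lambda>a. a \<otimes>\<^bsub>G\<^esub> b) ` ?J). y = \<phi> \<gamma> x)"
        by (simp only: UN_iff Bex_def image_iff) blast
      finally show ?thesis .
    qed
    moreover have "finite (\<Union>b\<in>J. (\<lambda>a. a \<otimes>\<^bsub>G\<^esub> b) ` ?J)"
      by (intro finite_UN_I IH(1) finite_imageI J(1))
    moreover have "(\<Union>b\<in>J. (\<lambda>a. a \<otimes>\<^bsub>G\<^esub> b) ` ?J) \<subseteq> carrier G" using J(2) IH(2) by auto
    ultimately show ?case
      by (intro exI[of _ "\<Union>b\<in>J. (\<lambda>a. a \<otimes>\<^bsub>G\<^esub> b) ` ?J"] conjI ballI allI)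
  qed
qed

text \<open>The infimum is finite only if some \<open>s\<close> qualifies. Within \<open>Y\<close>,
  a step of the reflexive power is a loop or an edge of the power graph, and loops do not enlarge
  components.\<close>

lemma asi_finite_cover:
  fixes M :: "'a measure"
  assumes "asi M E < \<infinity>"
  obtains s where "\<And>k. \<exists>Y :: nat \<Rightarrow> 'a set. (\<forall>i\<le>s. Y i \<in> sets M \<and>
    (\<forall>y\<in>Y i. finite ((((adj E)\<^sup>=) ^^ k \<inter> Y i \<times> Y i)\<^sup>* `` {y}))) \<and> (\<Union>i\<le>s. Y i) = space M"
proof -
  have "{enat s | s. \<forall>k. \<exists>Y :: nat \<Rightarrow> 'a set.
     (\<forall>i\<le>s. Y i \<in> sets M \<and> graph_finite (graph_power E k) (Y i)) \<and> (\<Union>i\<le>s. Y i) = space M} \<noteq> {}"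
    using assms unfolding asi_def by (auto simp: Inf_enat_def split: if_splits)
  then obtain s where s: "\<And>k. \<exists>Y :: nat \<Rightarrow> 'a set.
     (\<forall>i\<le>s. Y i \<in> sets M \<and> graph_finite (graph_power E k) (Y i)) \<and> (\<Union>i\<le>s. Y i) = space M"
    by auto
  have fin: "finite ((((adj E)\<^sup>=) ^^ k \<inter> Y \<times> Y)\<^sup>* `` {y})"
    if Y: "graph_finite (graph_power E k) Y" "y \<in> Y" for k y Y
  proof -
    have "((adj E)\<^sup>=) ^^ k \<inter> Y \<times> Y \<subseteq> (adj (induced_edges (graph_power E k) Y))\<^sup>="
      unfolding graph_power_def graph_dist_pos_iff graph_dist_le_iff
      by (auto simp: adj_def induced_edges_def)
    then have "(((adj E)\<^sup>=) ^^ k \<inter> Y \<times> Y)\<^sup>* \<subseteq> (adj (induced_edges (graph_power E k) Y))\<^sup>*"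
      by (metis rtrancl_mono rtrancl_reflcl)
    then have "(((adj E)\<^sup>=) ^^ k \<inter> Y \<times> Y)\<^sup>* `` {y} \<subseteq> component (induced_edges (graph_power E k) Y) y"
      by (auto simp: component_def)
    then show ?thesis using Y finite_subset unfolding graph_finite_def by blast
  qed
  have "\<exists>Y :: nat \<Rightarrow> 'a set. (\<forall>i\<le>s. Y i \<in> sets M \<and>
    (\<forall>y\<in>Y i. finite ((((adj E)\<^sup>=) ^^ k \<inter> Y i \<times> Y i)\<^sup>* `` {y}))) \<and> (\<Union>i\<le>s. Y i) = space M" for k
  proof -
    obtain Y :: "nat \<Rightarrow> 'a set" where
      Y: "\<forall>i\<le>s. Y i \<in> sets M \<and> graph_finite (graph_power E k) (Y i)" "(\<Union>i\<le>s. Y i) = space M"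
      using s[of k] by (elim exE conjE) (rule that)
    show ?thesis by (rule exI[of _ Y]) (use Y fin in simp)
  qed
  then show thesis by (rule that)
qed

section \<open>Expansion of paradoxical sets and conclusion\<close>

text \<open>Both bijections displace points by a bounded distance \<open>m\<close>. Iterating them
  \<open>n\<close> times gives the factor \<open>2 ^ n\<close>, which is at least
  \<open>n\<close>.\<close>

lemma paradoxical_expands:
  assumes act: "group_action G X \<phi>" and A: "A \<subseteq> X" and par: "paradoxical G \<phi> A"
    and S: "finite_generating_set G S"
  shows "\<exists>r. expands (((adj (schreier X \<phi> S))\<^sup>=) ^^ r) n A A"
proof -
  let ?R = "(adj (schreier X \<phi> S))\<^sup>="
  have S': "finite S" "S \<subseteq> carrier G" "generate G S = carrier G"
    using S by (auto simp: finite_generating_set_def)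
  obtain A0 A1 where A01: "A = A0 \<union> A1" "A0 \<inter> A1 = {}"
    "equidecomposable G \<phi> A A0" "equidecomposable G \<phi> A A1"
    using par unfolding paradoxical_def by blast
  obtain f0 R0 where f0: "bij_betw f0 A A0" "finite R0" "R0 \<subseteq> carrier G" "\<forall>x\<in>A. \<exists>\<gamma>\<in>R0. f0 x = \<phi> \<gamma> x"
    using equidecomposable_map[OF act A A01(3)] by blast
  obtain f1 R1 where f1: "bij_betw f1 A A1" "finite R1" "R1 \<subseteq> carrier G" "\<forall>x\<in>A. \<exists>\<gamma>\<in>R1. f1 x = \<phi> \<gamma> x"
    using equidecomposable_map[OF act A A01(4)] by blast
  have "\<forall>\<gamma>\<in>R0 \<union> R1. \<exists>m. \<forall>x\<in>X. (x, \<phi> \<gamma> x) \<in> ?R ^^ m"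
    using generate_moves_bounded[OF act S'(2)] S'(3) f0(3) f1(3) by blast
  then obtain b where b: "\<And>\<gamma> x. \<gamma> \<in> R0 \<union> R1 \<Longrightarrow> x \<in> X \<Longrightarrow> (x, \<phi> \<gamma> x) \<in> ?R ^^ b \<gamma>" by metis
  \<comment> \<open>Inserting 0 gives \<open>Max\<close> a value also when no group elements
    occur.\<close>
  define m where "m = Max (insert 0 (b ` (R0 \<union> R1)))"
  have m: "(x, \<phi> \<gamma> x) \<in> ?R ^^ m" if "\<gamma> \<in> R0 \<union> R1" "x \<in> X" for \<gamma> x
  proof -
    have "b \<gamma> \<le> m" unfolding m_def using f0(2) f1(2) that by (intro Max_ge) auto
    then show ?thesis using b[OF that] relpow_reflcl_mono by blast
  qed
  have "expands ((?R ^^ m) ^^ n) (2 ^ n) A A"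
  proof (rule expands_if_doubling)
    show "inj_on f0 A" "f0 ` A \<subseteq> A" "inj_on f1 A" "f1 ` A \<subseteq> A" "f0 ` A \<inter> f1 ` A = {}"
      using f0(1) f1(1) A01(1,2) by (auto simp: bij_betw_def)
    show "(x, f0 x) \<in> ?R ^^ m \<and> (x, f1 x) \<in> ?R ^^ m" if "x \<in> A" for x
      using f0(4) f1(4) m that A by (metis UnI1 UnI2 subsetD)
    show "finite (((?R ^^ m) ^^ p) `` {x})" if x: "x \<in> A" for x p
    proof -
      obtain J where J: "finite J" "\<forall>x\<in>X. \<forall>y. (x, y) \<in> ?R ^^ (m * p) \<longleftrightarrow> (\<exists>\<gamma>\<in>J. y = \<phi> \<gamma> x)"
        using schreier_ball_iff[OF act S'(1,2)] by blast
      have "(?R ^^ (m * p)) `` {x} = (\<lambda>\<gamma>. \<phi> \<gamma> x) ` J" using J(2) x A by blast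
      then show ?thesis using J(1) by (simp only: relpow_relpow finite_imageI)
    qed
  qed
  then have "expands (?R ^^ (m * n)) (2 ^ n) A A" by (simp only: relpow_relpow)
  moreover have "n * c \<le> 2 ^ n * c" for c :: nat by (simp add: less_imp_le)
  ultimately have "expands (?R ^^ (m * n)) n A A"
    unfolding expands_def using order_trans by blast
  then show ?thesis by blast
qed

theorem theorem1p29:
  fixes G :: "('g, 'r) monoid_scheme" and M :: "'a measure" and \<phi> :: "'g \<Rightarrow> 'a \<Rightarrow> 'a"
    and A :: "'a set"
  assumes "group G" and "finitely_generated G"
    and "standard_borel M" and "borel_action G M \<phi>"
    and "asi_action G M \<phi> < \<infinity>"
    and "A \<in> sets M" and "paradoxical G \<phi> A"
  shows "borel_paradoxical G M \<phi> A"
proof -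
  have act: "group_action G (space M) \<phi>" and meas: "\<And>\<gamma>. \<gamma> \<in> carrier G \<Longrightarrow> \<phi> \<gamma> \<in> measurable M M"
    using assms(4) by (auto simp: borel_action_def)
  interpret group G by (rule assms(1))
  interpret group_action G "space M" \<phi> by (rule act)
  obtain S where S: "finite_generating_set G S" using assms(2) by (auto simp: finitely_generated_def)
  then have S': "finite S" "S \<subseteq> carrier G" "generate G S = carrier G"
    by (auto simp: finite_generating_set_def)
  let ?R = "(adj (schreier (space M) \<phi> S))\<^sup>="
  have AM: "A \<subseteq> space M" using assms(6) sets.sets_into_space by blast
  obtain s where s: "\<And>k. \<exists>Y :: nat \<Rightarrow> 'a set. (\<forall>i\<le>s. Y i \<in> sets M \<and>
      (\<forall>y\<in>Y i. finite ((?R ^^ k \<inter> Y i \<times> Y i)\<^sup>* `` {y}))) \<and> (\<Union>i\<le>s. Y i) = space M"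
    using asi_finite_cover[of M "schreier (space M) \<phi> S"] assms(5) asi_action_eq[OF act S] by auto
  \<comment> \<open>One unit of expansion for each of the \<open>s + 1\<close> covering sets, and 2
    for the two injections.\<close>
  obtain r where r: "expands (?R ^^ r) (Suc s + 2) A A"
    using paradoxical_expands[OF act AM assms(7) S] by blast
  obtain V :: "nat \<Rightarrow> 'a set" where V: "\<And>m. V m \<in> sets M"
    "\<And>F x. \<lbrakk>finite F; F \<subseteq> space M; x \<in> F\<rbrakk> \<Longrightarrow> \<exists>m. V m \<inter> F = {x}"
    using standard_borel_separating[OF assms(3)] by metis
  obtain J where J: "finite J" "J \<subseteq> carrier G"
    "\<forall>x\<in>space M. \<forall>y. (x, y) \<in> ?R ^^ r \<longleftrightarrow> (\<exists>\<gamma>\<in>J. y = \<phi> \<gamma> x)"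
    using schreier_ball_iff[OF act S'(1,2), of r] by (elim exE conjE) (rule that)
  have cnt: "countable (carrier G)"
    using countable_generate[OF countable_finite[OF S'(1)] S'(2)] S'(3) by simp
  \<comment> \<open>The carrier is nonempty, so all values of the enumeration lie in it.\<close>
  define e where "e = from_nat_into (carrier G)"
  have e: "e i \<in> carrier G" for i unfolding e_def using one_closed by (intro from_nat_into) blast
  have e_surj: "\<exists>i. e i = \<gamma>" if "\<gamma> \<in> carrier G" for \<gamma>
    unfolding e_def using from_nat_into_to_nat_on[OF cnt that] by blast
  define I where "I = to_nat_on (carrier G) ` J"
  have "e ` I = (\<lambda>\<gamma>. \<gamma>) ` J"
    unfolding I_def image_image e_def
    by (intro image_cong refl from_nat_into_to_nat_on[OF cnt] subsetD[OF J(2)])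
  then have e_I: "e ` I = J" by simp
  \<comment> \<open>One step of \<open>\<rho>\<close> is a move within a Schreier ball of radius
    \<open>r\<close>.\<close>
  interpret borel_graph M "\<lambda>i. \<phi> (e i)" V "?R ^^ r" I
  proof
    show "\<exists>k. \<forall>x\<in>space M. \<phi> (e i) (\<phi> (e j) x) = \<phi> (e k) x" for i j
      using e_surj[of "e i \<otimes>\<^bsub>G\<^esub> e j"] composition_rule e by (metis m_closed)
    show "\<exists>j. \<forall>x\<in>space M. \<phi> (e j) (\<phi> (e i) x) = x" for i
      using e_surj[of "inv\<^bsub>G\<^esub> e i"] orbit_sym_aux e by (metis inv_closed)
    show "sym (?R ^^ r)" using sym_adj by (intro relpow_sym sym_Un sym_Id)
    show "refl (?R ^^ r)" by (auto simp: refl_on_def relpow_reflcl_le intro!: exI[of _ 0])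
    show "finite I" using J(1) by (simp add: I_def)
    show "(x, y) \<in> ?R ^^ r \<longleftrightarrow> (\<exists>i\<in>I. y = \<phi> (e i) x)" if "x \<in> space M" for x y
      using J(3) that unfolding e_I[symmetric] by blast
  qed (use V meas e in auto)
  \<comment> \<open>The bound in \<open>borel_matching_exists\<close> for \<open>N = Suc s\<close>
    and \<open>d = 2\<close>. As \<open>?K\<close> steps of \<open>\<rho>\<close> make
    \<open>r * ?K\<close> graph steps, the cover is taken at that scale.\<close>
  let ?K = "4 * (Suc s + 2)"
  obtain Y :: "nat \<Rightarrow> 'a set" where Y: "\<forall>i\<le>s. Y i \<in> sets M \<and>
      (\<forall>y\<in>Y i. finite ((?R ^^ (r * ?K) \<inter> Y i \<times> Y i)\<^sup>* `` {y}))" "(\<Union>i\<le>s. Y i) = space M"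
    using s[of "r * ?K"] by (elim exE conjE) (rule that)
  have "\<exists>f. borel_matching 2 (A \<inter> (\<Union>i<Suc s. Y i)) A f"
  proof (rule borel_matching_exists[OF assms(6) assms(6) r order_refl])
    show "Y i \<in> sets M" if "i < Suc s" for i using Y(1) that by simp
    show "finite (((?R ^^ r) ^^ ?K \<inter> Y i \<times> Y i)\<^sup>* `` {y})" if "i < Suc s" "y \<in> Y i" for i y
      unfolding relpow_relpow using Y(1) that by simp
  qed
  moreover have "A \<inter> (\<Union>i<Suc s. Y i) = A" using Y(2) AM by (auto simp: lessThan_Suc_atMost)
  ultimately obtain f where "borel_matching 2 A A f" by auto
  then show ?thesis using e by (intro borel_paradoxical_if_matching[OF _ assms(6)]) auto
qed

end
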